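(* Let $G$ be a group and let $R$ be a ring strongly graded by $G$ such that the base ring $R_1$ is a domain. Then: (a) $R$ satisfies SRC if and only if $R_1$ satisfies SRC and $G$ is amenable; (b) $R$ satisfies LSRC if and only if $R_1$ satisfies LSRC and $G$ is amenable.
   Context: Rings are associative with identity element $1$ and are not assumed commutative; a domain is a nonzero (not necessarily commutative) ring without zero divisors other than $0$. Groups are discrete. A ring $R$ satisfies the strong rank condition (SRC) if, for every natural number $n$, there is no right $R$-module monomorphism $R^{n+1}\to R^n$. It satisfies the left strong rank condition (LSRC) if, for every natural number $n$, there is no left $R$-module monomorphism $R^{n+1}\to R^n$. A ring $R$ is graded by a group $G$ if the underlying additive group of $R$ is a direct sum $R=\bigoplus_{g\in G}R_g$ of abelian subgroups $R_g$ such that $R_gR_h\subseteq R_{gh}$ for all $g,h\in G$, where $R_gR_h$ denotes the additive subgroup generated by all products $rs$ with $r\in R_g$, $s\in R_h$. In this case $R_1$ (the component at the identity of $G$) is a subring of $R$, called the base ring. $R$ is strongly graded by $G$ if $R_gR_h=R_{gh}$ for all $g,h\in G$. *)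

theory Defs
  imports Complex_Main "HOL-Algebra.Algebra"
begin

text \<open>The library's \<^locale>\<open>domain\<close> is commutative; here commutativity is not assumed.\<close>

locale noncommutative_domain = ring R for R (structure) +
  assumes one_not_zero: "\<one> \<noteq> \<zero>"
    and integral: "\<lbrakk>a \<in> carrier R; b \<in> carrier R; a \<otimes> b = \<zero>\<rbrakk> \<Longrightarrow> a = \<zero> \<or> b = \<zero>"

section \<open>Free modules and the strong rank conditions\<close>

text \<open>The library's modules are over commutative rings only. Elements of \<open>R\<^sup>n\<close> are extensional
  functions on \<open>{..<n}\<close>, so that \<open>R\<^sup>0\<close> has exactly one element.\<close>

definition free_carrier :: "('r, 'm) ring_scheme \<Rightarrow> nat \<Rightarrow> (nat \<Rightarrow> 'r) set" where
  "free_carrier R n = ({..<n} \<rightarrow>\<^sub>E carrier R)"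

definition free_add ::
    "('r, 'm) ring_scheme \<Rightarrow> nat \<Rightarrow> (nat \<Rightarrow> 'r) \<Rightarrow> (nat \<Rightarrow> 'r) \<Rightarrow> nat \<Rightarrow> 'r" where
  "free_add R n x y = (\<lambda>i\<in>{..<n}. x i \<oplus>\<^bsub>R\<^esub> y i)"

definition free_rscale ::
    "('r, 'm) ring_scheme \<Rightarrow> nat \<Rightarrow> (nat \<Rightarrow> 'r) \<Rightarrow> 'r \<Rightarrow> nat \<Rightarrow> 'r" where
  "free_rscale R n x r = (\<lambda>i\<in>{..<n}. x i \<otimes>\<^bsub>R\<^esub> r)"

definition free_lscale ::
    "('r, 'm) ring_scheme \<Rightarrow> nat \<Rightarrow> 'r \<Rightarrow> (nat \<Rightarrow> 'r) \<Rightarrow> nat \<Rightarrow> 'r" where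
  "free_lscale R n r x = (\<lambda>i\<in>{..<n}. r \<otimes>\<^bsub>R\<^esub> x i)"

definition right_module_hom ::
    "('r, 'm) ring_scheme \<Rightarrow> nat \<Rightarrow> nat \<Rightarrow> ((nat \<Rightarrow> 'r) \<Rightarrow> (nat \<Rightarrow> 'r)) set" where
  "right_module_hom R m n = {f \<in> free_carrier R m \<rightarrow> free_carrier R n.
     (\<forall>x \<in> free_carrier R m. \<forall>y \<in> free_carrier R m.
        f (free_add R m x y) = free_add R n (f x) (f y)) \<and>
     (\<forall>x \<in> free_carrier R m. \<forall>r \<in> carrier R.
        f (free_rscale R m x r) = free_rscale R n (f x) r)}"

definition left_module_hom ::
    "('r, 'm) ring_scheme \<Rightarrow> nat \<Rightarrow> nat \<Rightarrow> ((nat \<Rightarrow> 'r) \<Rightarrow> (nat \<Rightarrow> 'r)) set" where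
  "left_module_hom R m n = {f \<in> free_carrier R m \<rightarrow> free_carrier R n.
     (\<forall>x \<in> free_carrier R m. \<forall>y \<in> free_carrier R m.
        f (free_add R m x y) = free_add R n (f x) (f y)) \<and>
     (\<forall>x \<in> free_carrier R m. \<forall>r \<in> carrier R.
        f (free_lscale R m r x) = free_lscale R n r (f x))}"

definition SRC :: "('r, 'm) ring_scheme \<Rightarrow> bool" where
  "SRC R \<longleftrightarrow>
     (\<forall>n. \<not> (\<exists>f \<in> right_module_hom R (n + 1) n. inj_on f (free_carrier R (n + 1))))"

definition LSRC :: "('r, 'm) ring_scheme \<Rightarrow> bool" where
  "LSRC R \<longleftrightarrow>
     (\<forall>n. \<not> (\<exists>f \<in> left_module_hom R (n + 1) n. inj_on f (free_carrier R (n + 1))))"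

section \<open>Amenable discrete groups\<close>

text \<open>Von Neumann's definition: there is a finitely additive, left-translation-invariant
  probability measure defined on all subsets of the group.\<close>

definition amenable :: "('g, 'm) monoid_scheme \<Rightarrow> bool" where
  "amenable G \<longleftrightarrow> (\<exists>P :: 'g set \<Rightarrow> real.
     (\<forall>S. S \<subseteq> carrier G \<longrightarrow> 0 \<le> P S) \<and>
     P (carrier G) = 1 \<and>
     (\<forall>S T. S \<subseteq> carrier G \<longrightarrow> T \<subseteq> carrier G \<longrightarrow> S \<inter> T = {} \<longrightarrow> P (S \<union> T) = P S + P T) \<and>
     (\<forall>g \<in> carrier G. \<forall>S. S \<subseteq> carrier G \<longrightarrow> P (g <#\<^bsub>G\<^esub> S) = P S))"

section \<open>Group-graded rings\<close>

definition subgroup_product :: "('r, 'm) ring_scheme \<Rightarrow> 'r set \<Rightarrow> 'r set \<Rightarrow> 'r set" where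
  "subgroup_product R A B = generate (add_monoid R) (A <#>\<^bsub>R\<^esub> B)"

text \<open>Finiteness of the support is essential in \<open>direct_sum\<close>: the library's
  \<^const>\<open>finsum\<close> is constantly zero on infinite index sets.\<close>

locale graded_ring = G: group G + R: ring R
  for G :: "('g, 'm) monoid_scheme" and R :: "('r, 'n) ring_scheme" +
  fixes A :: "'g \<Rightarrow> 'r set"
  assumes component_subgroup: "g \<in> carrier G \<Longrightarrow> additive_subgroup (A g) R"
    and direct_sum: "x \<in> carrier R \<Longrightarrow>
      \<exists>!c. c \<in> (\<Pi>\<^sub>E g \<in> carrier G. A g) \<and>
           finite {g \<in> carrier G. c g \<noteq> \<zero>\<^bsub>R\<^esub>} \<and>
           x = (\<Oplus>\<^bsub>R\<^esub> g \<in> {g \<in> carrier G. c g \<noteq> \<zero>\<^bsub>R\<^esub>}. c g)"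
    and component_mult: "\<lbrakk>g \<in> carrier G; h \<in> carrier G\<rbrakk> \<Longrightarrow>
      subgroup_product R (A g) (A h) \<subseteq> A (g \<otimes>\<^bsub>G\<^esub> h)"

locale strongly_graded_ring = graded_ring +
  assumes component_mult_eq: "\<lbrakk>g \<in> carrier G; h \<in> carrier G\<rbrakk> \<Longrightarrow>
      subgroup_product R (A g) (A h) = A (g \<otimes>\<^bsub>G\<^esub> h)"

definition base_ring ::
    "('g, 'm) monoid_scheme \<Rightarrow> ('r, 'n) ring_scheme \<Rightarrow> ('g \<Rightarrow> 'r set) \<Rightarrow> ('r, 'n) ring_scheme" where
  "base_ring G R A = R\<lparr>carrier := A \<one>\<^bsub>G\<^esub>\<rparr>"

end

theory Submission
  imports Defs "HOL-Analysis.Function_Topology"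
begin

text \<open>Write \<open>R\<^sub>1\<close> for the base ring. A module homomorphism \<open>R\<^sup>m \<rightarrow> R\<^sup>n\<close> is a matrix, so the strong rank condition says that every
homogeneous linear system with more unknowns than equations has a nonzero solution
(\<open>SRC_imp_nontrivial_kernel\<close>, \<open>SRC_if_nontrivial_kernels\<close>). Strong grading and the absence of zero
divisors in \<open>R\<^sub>1\<close> give two tools: a nonzero element of \<open>R\<close> keeps a nonzero multiple under some
element of any prescribed degree, and a product of two nonzero homogeneous elements is nonzero
(\<open>homogeneous_no_zero_divisors\<close>). In particular each component contains a nonzero element
\<open>rep g\<close>, by which degrees can be shifted.

If \<open>R\<close> satisfies SRC, then so does \<open>R\<^sub>1\<close>: a solution over \<open>R\<close> of a system over \<open>R\<^sub>1\<close> has a nonzero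
homogeneous part, which is again a solution, and a right multiple of that part lies in \<open>R\<^sub>1\<close>.

If \<open>R\<^sub>1\<close> satisfies SRC and \<open>G\<close> is amenable, look for a solution of a wide system over \<open>R\<close> among
vectors supported in a finite set \<open>F\<close> of degrees. This is a linear system over \<open>R\<^sub>1\<close> with one
unknown for each old unknown and each element of \<open>F\<close>, and one equation for each old equation and
each element of \<open>S F\<close>, where \<open>S\<close> is the finite set of degrees in the coefficients. Amenability makes
\<open>S F\<close> so little larger than \<open>F\<close> that the new system is still wide
(\<open>amenable_small_expansion\<close>). If no such \<open>F\<close> existed, the marriage theorem would match \<open>m\<close> copies
of \<open>G\<close> injectively into \<open>n < m\<close> copies by finitely many left translations, against the invariant
measure.

If \<open>G\<close> is not amenable, an injective wide matrix over \<open>R\<close> is built from a finite relation with the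
unique-neighbour property (\<open>unique_neighbours\<close>): left vertices \<open>G \<times> J\<close>, right vertices \<open>G \<times> I\<close>
with \<open>I\<close> smaller than \<open>J\<close>, edges invariant under right translation, and every finite nonempty set of
left vertices has a right neighbour that it meets in a single edge. Reading the edges as matrix
entries \<open>rep s\<close>, a nonzero vector cannot be killed: at a right vertex with a unique edge into its
support the product has a single, nonzero summand. The relation combines three ingredients.
Non-amenability gives, after taking powers, a finite set \<open>S\<close> with \<open>card (S F)\<close> at least \<open>card F\<close>
times any given multiple of \<open>ln (card S)\<close>. Random sparse subsets of \<open>S\<close> isolate a point of any given
subset with probability at least a constant over \<open>ln (card S)\<close>; hence some \<open>g\<close> in the support has
its own translates isolated more often than there are random subsets. Finally \<open>J\<close> and \<open>I\<close> are grids,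
and the edges with different labels move points of \<open>J\<close> along different slopes, so that one of these
many slopes has a unique extreme point on the fibre of the support over \<open>g\<close>.

The left-handed statement follows by applying the right-handed one to the opposite ring, which is
strongly graded by the same group once degrees are inverted.\<close>

section \<open>The marriage theorem for infinite families of finite sets\<close>

text \<open>Rado's argument: delete as many admissible pairs \<open>(v, w)\<close> as possible while Hall's condition
survives. Finiteness of the sets \<open>N v\<close> lets the condition pass to unions of chains of deletions. In a
maximal deletion two remaining choices for the same \<open>v\<close> would both be critical, which contradicts the
submodularity of the cardinality of neighbourhoods; so the remaining pairs form a function.\<close>

lemma hall_locally_finite:
  fixes N :: "'v \<Rightarrow> 'w set"
  assumes fin: "\<And>v. v \<in> V \<Longrightarrow> finite (N v)"
    and hall: "\<And>Z. finite Z \<Longrightarrow> Z \<subseteq> V \<Longrightarrow> card Z \<le> card (\<Union>(N ` Z))"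
  obtains \<phi> where "inj_on \<phi> V" "\<And>v. v \<in> V \<Longrightarrow> \<phi> v \<in> N v"
proof -
  \<comment> \<open>\<open>nb D Z\<close> is the neighbourhood of \<open>Z\<close> after the pairs in \<open>D\<close> have been deleted.\<close>
  define nb where "nb D Z = {w. \<exists>v\<in>Z. w \<in> N v \<and> (v, w) \<notin> D}" for D :: "('v \<times> 'w) set" and Z
  have nb_fin: "finite (nb D Z)" if "finite Z" "Z \<subseteq> V" for D Z
    by (rule finite_subset[of _ "\<Union>(N ` Z)"]) (use that fin in \<open>auto simp: nb_def\<close>)
  define \<D> where "\<D> = {D. \<forall>Z. finite Z \<longrightarrow> Z \<subseteq> V \<longrightarrow> card Z \<le> card (nb D Z)}"
  have "\<exists>D\<in>\<D>. \<forall>D'\<in>\<D>. D \<subseteq> D' \<longrightarrow> D' = D"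
  proof (rule subset_Zorn_nonempty)
    have "nb {} Z = \<Union>(N ` Z)" for Z
      by (auto simp: nb_def)
    then have "{} \<in> \<D>"
      using hall by (simp add: \<D>_def)
    then show "\<D> \<noteq> {}" by blast
  next
    fix \<C> assume ne: "\<C> \<noteq> {}" and ch: "subset.chain \<D> \<C>"
    show "\<Union>\<C> \<in> \<D>"
      unfolding \<D>_def
    proof (intro CollectI allI impI)
      fix Z assume Z: "finite Z" "Z \<subseteq> V"
      have "finite (\<Union>\<C> \<inter> Sigma Z N)"
        using Z fin by (intro finite_Int disjI2 finite_SigmaI) auto
      then obtain D where D: "D \<in> \<C>" "\<Union>\<C> \<inter> Sigma Z N \<subseteq> D"
        by (rule finite_subset_Union_chain[OF _ Int_lower1 ne ch])
      have "nb (\<Union>\<C>) Z = nb D Z"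
      proof -
        have "(v, w) \<in> \<Union>\<C> \<longleftrightarrow> (v, w) \<in> D" if "v \<in> Z" "w \<in> N v" for v w
          using D that by blast
        then show ?thesis
          unfolding nb_def by blast
      qed
      moreover have "D \<in> \<D>"
        using ch D(1) by (auto simp: subset.chain_def)
      ultimately show "card Z \<le> card (nb (\<Union>\<C>) Z)"
        using Z by (auto simp: \<D>_def)
    qed
  qed
  then obtain D where D: "D \<in> \<D>" and max: "\<And>D'. D' \<in> \<D> \<Longrightarrow> D \<subseteq> D' \<Longrightarrow> D' = D"
    by blast
  have hallD: "card Z \<le> card (nb D Z)" if "finite Z" "Z \<subseteq> V" for Z
    using D that by (auto simp: \<D>_def)
  \<comment> \<open>By maximality, deleting one more pair \<open>(v, a)\<close> violates Hall's condition at some set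
      containing \<open>v\<close>; here \<open>v\<close> itself has been removed from that set.\<close>
  have tight: "\<exists>Z. finite Z \<and> Z \<subseteq> V \<and> v \<notin> Z \<and> card (nb D Z \<union> (nb D {v} - {a})) \<le> card Z"
    if v: "v \<in> V" and a: "a \<in> nb D {v}" for v a
  proof -
    have "insert (v, a) D \<notin> \<D>"
      using max[of "insert (v, a) D"] a by (auto simp: nb_def)
    then obtain Z where Z: "finite Z" "Z \<subseteq> V" "card (nb (insert (v, a) D) Z) < card Z"
      by (auto simp: \<D>_def not_le)
    have "v \<in> Z"
    proof (rule ccontr)
      assume "v \<notin> Z"
      then have "nb (insert (v, a) D) Z = nb D Z"
        by (auto simp: nb_def)
      with Z hallD[of Z] show False by simp
    qed
    have "nb (insert (v, a) D) Z = nb D (Z - {v}) \<union> (nb D {v} - {a})"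
      using \<open>v \<in> Z\<close> by (auto simp: nb_def)
    moreover have "card Z = Suc (card (Z - {v}))"
      using \<open>v \<in> Z\<close> Z(1) by (rule card.remove[rotated])
    ultimately show ?thesis
      using Z by (intro exI[of _ "Z - {v}"]) auto
  qed
  have single: "a = b" if v: "v \<in> V" and ab: "a \<in> nb D {v}" "b \<in> nb D {v}" for v a b
  proof (rule ccontr)
    assume "a \<noteq> b"
    obtain Z where Z: "finite Z" "Z \<subseteq> V" "v \<notin> Z" "card (nb D Z \<union> (nb D {v} - {a})) \<le> card Z"
      using tight[OF v ab(1)] by blast
    obtain Y where Y: "finite Y" "Y \<subseteq> V" "v \<notin> Y" "card (nb D Y \<union> (nb D {v} - {b})) \<le> card Y"
      using tight[OF v ab(2)] by blast
    let ?P = "nb D Z \<union> (nb D {v} - {a})" and ?Q = "nb D Y \<union> (nb D {v} - {b})"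
    have finPQ: "finite ?P" "finite ?Q"
      using nb_fin[of Z D] nb_fin[of Y D] nb_fin[of "{v}" D] Z Y v by simp_all
    have "?P \<union> ?Q = nb D (insert v (Z \<union> Y))"
      using \<open>a \<noteq> b\<close> by (auto simp: nb_def)
    then have "card (insert v (Z \<union> Y)) \<le> card (?P \<union> ?Q)"
      using hallD[of "insert v (Z \<union> Y)"] Z Y v by simp
    then have "Suc (card (Z \<union> Y)) \<le> card (?P \<union> ?Q)"
      using Z Y by simp
    moreover have "card (Z \<inter> Y) \<le> card (?P \<inter> ?Q)"
    proof -
      have "card (Z \<inter> Y) \<le> card (nb D (Z \<inter> Y))"
        using hallD[of "Z \<inter> Y"] Z Y by auto
      also have "\<dots> \<le> card (?P \<inter> ?Q)"
        by (rule card_mono) (use finPQ in \<open>auto simp: nb_def\<close>)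
      finally show ?thesis .
    qed
    ultimately show False
      using card_Un_Int[OF finPQ] card_Un_Int[OF Z(1) Y(1)] Z(4) Y(4) by linarith
  qed
  have "nb D {v} \<noteq> {}" if "v \<in> V" for v
    using hallD[of "{v}"] that by auto
  then have "\<forall>v\<in>V. \<exists>w. w \<in> nb D {v}"
    by blast
  then obtain \<phi> where \<phi>: "\<And>v. v \<in> V \<Longrightarrow> \<phi> v \<in> nb D {v}"
    by (metis (no_types))
  have "inj_on \<phi> V"
  proof (rule inj_onI, rule ccontr)
    fix v w assume vw: "v \<in> V" "w \<in> V" "\<phi> v = \<phi> w" "v \<noteq> w"
    have "nb D {v, w} \<subseteq> {\<phi> v}"
    proof
      fix x assume "x \<in> nb D {v, w}"
      then have "x \<in> nb D {v} \<or> x \<in> nb D {w}"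
        by (auto simp: nb_def)
      then show "x \<in> {\<phi> v}"
        using single[OF vw(1) _ \<phi>[OF vw(1)], of x] single[OF vw(2) _ \<phi>[OF vw(2)], of x] vw(3) by auto
    qed
    then have "card (nb D {v, w}) \<le> 1"
      using card_mono[of "{\<phi> v}"] by fastforce
    moreover have "card {v, w} \<le> card (nb D {v, w})"
      using vw by (intro hallD) auto
    ultimately show False using vw by simp
  qed
  with \<phi> show thesis
    by (intro that) (auto simp: nb_def)
qed

section \<open>Directions with a unique maximum\<close>

text \<open>As the slope \<open>\<sigma>\<close> grows, the maximisers of \<open>e + \<sigma> * j\<close> on a finite planar set move weakly to the
right. A slope with two maximisers pushes the column strictly to the right, so there are fewer such
slopes than columns. Geometrically, they are the slopes of the upper edges of the convex hull.\<close>

lemma unique_maximum_in_some_direction: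
  fixes E :: "(nat \<times> nat) set" and T :: "nat set"
  assumes E: "finite E" "E \<noteq> {}" "\<And>j e. (j, e) \<in> E \<Longrightarrow> j < M"
    and T: "finite T" "M \<le> card T"
  obtains (witness) \<sigma> j e where "\<sigma> \<in> T" "(j, e) \<in> E"
    "\<And>j' e'. (j', e') \<in> E \<Longrightarrow> e + \<sigma> * j \<le> e' + \<sigma> * j' \<Longrightarrow> j' = j \<and> e' = e"
proof (rule ccontr)
  assume no: "\<not> thesis"
  have none: "\<exists>p'\<in>E. snd p + \<sigma> * fst p \<le> snd p' + \<sigma> * fst p' \<and> p' \<noteq> p"
    if "\<sigma> \<in> T" "p \<in> E" for \<sigma> p
  proof (rule ccontr)
    assume "\<not> ?thesis"
    then have thesis
      using that by (intro witness[of \<sigma> "fst p" "snd p"]) force+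
    with no show False ..
  qed
  define top where "top \<sigma> p \<longleftrightarrow> p \<in> E \<and> (\<forall>p'\<in>E. snd p' + \<sigma> * fst p' \<le> snd p + \<sigma> * fst p)"
    for \<sigma> and p :: "nat \<times> nat"
  have later: "fst p \<le> fst p'" if "top \<sigma> p" "top \<sigma>' p'" "\<sigma> < \<sigma>'" for \<sigma> \<sigma>' p p'
  proof -
    have "snd p' + \<sigma> * fst p' \<le> snd p + \<sigma> * fst p"
      and "snd p + \<sigma>' * fst p \<le> snd p' + \<sigma>' * fst p'"
      using that by (auto simp: top_def)
    then have "\<sigma> * fst p' + \<sigma>' * fst p \<le> \<sigma> * fst p + \<sigma>' * fst p'"
      by linarith
    moreover obtain k where "\<sigma>' = \<sigma> + Suc k"
      using \<open>\<sigma> < \<sigma>'\<close> less_iff_Suc_add by auto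
    ultimately have "Suc k * fst p \<le> Suc k * fst p'"
      by (simp add: algebra_simps)
    then show ?thesis by (metis Suc_mult_le_cancel1)
  qed
  have two: "\<exists>p p'. top \<sigma> p \<and> top \<sigma> p' \<and> fst p < fst p'" if \<sigma>: "\<sigma> \<in> T" for \<sigma>
  proof -
    let ?v = "\<lambda>p. snd p + \<sigma> * fst p"
    obtain p where p: "p \<in> E" "?v p = Max (?v ` E)"
      using Max_in[of "?v ` E"] E by fastforce
    have "top \<sigma> p"
      unfolding top_def using p E by (auto intro: Max_ge)
    obtain p' where p': "p' \<in> E" "?v p \<le> ?v p'" "p' \<noteq> p"
      using none[OF \<sigma> p(1)] by blast
    have "top \<sigma> p'"
      using \<open>top \<sigma> p\<close> p' unfolding top_def by (meson order_trans)
    moreover have "?v p' = ?v p"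
      using \<open>top \<sigma> p\<close> p' by (auto simp: top_def intro: antisym)
    then have "fst p \<noteq> fst p'"
      using p'(3) by (auto simp: prod_eq_iff)
    ultimately show ?thesis
      using \<open>top \<sigma> p\<close> by (metis nat_neq_iff)
  qed
  then obtain l r where lr: "\<And>\<sigma>. \<sigma> \<in> T \<Longrightarrow> top \<sigma> (l \<sigma>) \<and> top \<sigma> (r \<sigma>) \<and> fst (l \<sigma>) < fst (r \<sigma>)"
    by metis
  have less: "fst (l \<sigma>) < fst (l \<sigma>')" if "\<sigma> \<in> T" "\<sigma>' \<in> T" "\<sigma> < \<sigma>'" for \<sigma> \<sigma>'
    using lr[OF that(1)] lr[OF that(2)] later[OF _ _ that(3)] by (meson order_less_le_trans)
  have "inj_on (fst \<circ> l) T"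
    by (rule linorder_inj_onI') (use less in fastforce)
  moreover have "(fst \<circ> l) ` T \<subseteq> {..<M - 1}"
  proof
    fix a assume "a \<in> (fst \<circ> l) ` T"
    then obtain \<sigma> where \<sigma>: "\<sigma> \<in> T" "a = fst (l \<sigma>)"
      by auto
    then have "a < fst (r \<sigma>)" "r \<sigma> \<in> E"
      using lr[OF \<sigma>(1)] by (auto simp: top_def)
    then show "a \<in> {..<M - 1}"
      using E(3)[of "fst (r \<sigma>)" "snd (r \<sigma>)"] by simp
  qed
  ultimately have "card T \<le> M - 1"
    using card_inj_on_le[of "fst \<circ> l" T "{..<M - 1}"] by simp
  moreover obtain p where "p \<in> E"
    using E(2) by blast
  then have "M \<noteq> 0"
    using E(3)[of "fst p" "snd p"] by simp
  ultimately show False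
    using T(2) by linarith
qed

section \<open>Set families that isolate a point of every subset\<close>

text \<open>Bernoulli's inequality \<open>(1 - q / N) ^ (k - 1) \<ge> 1 / 2\<close>, cleared of denominators.\<close>

lemma two_times_power_ge:
  fixes N q k :: nat
  assumes "2 * q * k \<le> N" "0 < k"
  shows "N ^ (k - 1) \<le> 2 * (N - q) ^ (k - 1)"
proof (cases "N = 0")
  case True
  then show ?thesis by (cases "k - 1") auto
next
  case False
  have "q \<le> N"
    using assms by (cases k) auto
  have "1 - real (k - 1) * (q / N) \<ge> 1 / 2"
  proof -
    have "2 * real (k - 1) * real q \<le> 2 * real k * real q"
      by (intro mult_right_mono mult_left_mono) auto
    also have "\<dots> = 2 * real q * real k"
      by simp
    also have "\<dots> \<le> real N"
      using assms(1) by (metis of_nat_le_iff of_nat_mult of_nat_numeral)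
    finally show ?thesis
      using False by (simp add: field_simps)
  qed
  also have "1 - real (k - 1) * (q / N) \<le> (1 - real q / N) ^ (k - 1)"
    using Bernoulli_inequality[of "- (real q / N)" "k - 1"] \<open>q \<le> N\<close> False by simp
  also have "1 - real q / N = real (N - q) / N"
    using \<open>q \<le> N\<close> False by (simp add: field_simps of_nat_diff)
  finally have "real N ^ (k - 1) \<le> 2 * real (N - q) ^ (k - 1)"
    using False by (simp add: power_divide field_simps)
  then have "real (N ^ (k - 1)) \<le> real (2 * (N - q) ^ (k - 1))"
    by simp
  then show ?thesis
    by (simp only: of_nat_le_iff)
qed

text \<open>A uniformly random function \<open>f\<close> on \<open>S\<close> selects each point with probability \<open>q / N\<close>. If
this probability is between \<open>1 / (4 k)\<close> and \<open>1 / (2 k)\<close>, exactly one of the \<open>k\<close> points of \<open>I\<close> is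
selected with probability at least \<open>1 / 8\<close>.\<close>

lemma card_functions_isolating_ge:
  fixes S I :: "'s set" and N q :: nat
  assumes S: "finite S" "I \<subseteq> S" "I \<noteq> {}"
    and q: "2 * q * card I \<le> N" "N \<le> 4 * q * card I"
  shows "N ^ card S \<le> 8 * card {f \<in> S \<rightarrow>\<^sub>E {..<N}. \<exists>!s. s \<in> I \<and> f s < q}" (is "_ \<le> 8 * card ?H")
proof -
  define k where "k = card I"
  have finI: "finite I" and k: "0 < k" "k \<le> card S"
    using S by (auto simp: k_def card_gt_0_iff card_mono dest: finite_subset)
  have "q \<le> N"
    using q k by (cases k) (auto simp: k_def[symmetric])
  define B where "B s = (\<Pi>\<^sub>E t\<in>S. if t = s then {..<q} else if t \<in> I then {q..<N} else {..<N})" for s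
  have cardB: "card (B s) = q * ((N - q) ^ (k - 1) * N ^ (card S - k))" if s: "s \<in> I" for s
  proof -
    have "card (B s) = (\<Prod>t\<in>S. if t = s then q else if t \<in> I then N - q else N)"
      unfolding B_def using S(1) by (auto simp: card_PiE intro!: prod.cong)
    also have "\<dots> = q * (\<Prod>t\<in>S - {s}. if t \<in> I then N - q else N)"
      using S s by (subst prod.remove[of _ s]) (auto intro!: prod.cong)
    also have "(\<Prod>t\<in>S - {s}. if t \<in> I then N - q else N)
        = (N - q) ^ card ((S - {s}) \<inter> {t. t \<in> I}) * N ^ card ((S - {s}) \<inter> - {t. t \<in> I})"
      using S(1) by (subst prod.If_cases) auto
    also have "(S - {s}) \<inter> {t. t \<in> I} = I - {s}"
      using S by auto
    also have "(S - {s}) \<inter> - {t. t \<in> I} = S - I"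
      using s by auto
    finally show ?thesis
      using s S finI by (simp add: k_def card_Diff_subset)
  qed
  have BH: "(\<Union>s\<in>I. B s) \<subseteq> ?H"
  proof
    fix f assume "f \<in> (\<Union>s\<in>I. B s)"
    then obtain s where s: "s \<in> I" "f \<in> B s" by blast
    have val: "f t \<in> (if t = s then {..<q} else if t \<in> I then {q..<N} else {..<N})" if "t \<in> S" for t
      using s(2) that unfolding B_def by (rule PiE_mem)
    have "f t \<in> {..<N}" if "t \<in> S" for t
      using val[OF that] \<open>q \<le> N\<close> by (auto split: if_splits)
    moreover have "f t = undefined" if "t \<notin> S" for t
      using s(2) that unfolding B_def by (rule PiE_arb)
    ultimately have "f \<in> S \<rightarrow>\<^sub>E {..<N}"
      by (rule PiE_I)
    moreover have "f s < q"
      using val[of s] s S by auto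
    moreover have "t = s" if "t \<in> I" "f t < q" for t
      using val[of t] that S by (auto split: if_splits)
    ultimately show "f \<in> ?H"
      using s(1) by blast
  qed
  have disj: "B s \<inter> B t = {}" if "s \<in> I" "t \<in> I" "s \<noteq> t" for s t
  proof -
    have "f s < q \<and> q \<le> f s" if "f \<in> B s \<inter> B t" for f
    proof -
      have "s \<in> S"
        using \<open>s \<in> I\<close> S(2) by blast
      then have "f s \<in> (if s = s then {..<q} else if s \<in> I then {q..<N} else {..<N})"
        and "f s \<in> (if s = t then {..<q} else if s \<in> I then {q..<N} else {..<N})"
        using that unfolding B_def by blast+
      then show ?thesis
        using \<open>s \<in> I\<close> \<open>s \<noteq> t\<close> by simp
    qed
    then show ?thesis by fastforce
  qed
  have finB: "finite (B s)" for s
    unfolding B_def using S(1) by (intro finite_PiE) auto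
  have "N ^ card S = N * N ^ (k - 1) * N ^ (card S - k)"
    using k by (simp flip: power_Suc power_add)
  also have "\<dots> \<le> (4 * q * k) * (2 * (N - q) ^ (k - 1)) * N ^ (card S - k)"
    using q two_times_power_ge[OF _ k(1), of q N] by (intro mult_mono) (auto simp: k_def)
  also have "\<dots> = 8 * (\<Sum>s\<in>I. card (B s))"
    by (simp add: cardB k_def)
  also have "(\<Sum>s\<in>I. card (B s)) = card (\<Union>s\<in>I. B s)"
    using finI finB disj by (subst card_UN_disjoint) auto
  also have "8 * \<dots> \<le> 8 * card ?H"
    using BH S(1)
    by (intro mult_left_mono card_mono) (auto intro: finite_subset[OF _ finite_PiE[of S "\<lambda>_. {..<N}"]])
  finally show ?thesis .
qed

text \<open>The sets \<open>Y q\<close> are random subsets of \<open>S\<close>, with densities running through the powers of two down to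
\<open>1 / 2 ^ (L + 2)\<close>. Whatever the size of \<open>I\<close>, one of these densities suits it; the choice
among \<open>L + 2\<close> densities costs only a factor that is logarithmic in the bound \<open>2 ^ L\<close>.\<close>

lemma isolating_family:
  fixes S :: "'s set"
  assumes S: "finite S" "card S \<le> 2 ^ L"
  obtains Q :: "(nat \<times> ('s \<Rightarrow> nat)) set" and Y :: "nat \<times> ('s \<Rightarrow> nat) \<Rightarrow> 's set"
  where "finite Q" "Q \<noteq> {}"
    "\<And>I. I \<subseteq> S \<Longrightarrow> I \<noteq> {} \<Longrightarrow> card Q \<le> 8 * (L + 2) * card {q \<in> Q. \<exists>!s. s \<in> I \<inter> Y q}"
proof
  \<comment> \<open>The thresholds \<open>2 ^ l\<close> with \<open>l \<le> L + 1\<close> realise the densities \<open>2 ^ l / N\<close> up to \<open>1 / 2\<close>,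
      which suits a singleton.\<close>
  define N :: nat where "N = 2 ^ (L + 2)"
  define \<Phi> where "\<Phi> = S \<rightarrow>\<^sub>E {..<N}"
  define Q where "Q = {..<L + 2} \<times> \<Phi>"
  define Y where "Y = (\<lambda>(l, f). {s \<in> S. f s < (2::nat) ^ l})" for l :: nat and f :: "'s \<Rightarrow> nat"
  have card\<Phi>: "card \<Phi> = N ^ card S" "finite \<Phi>"
    using S by (auto simp: \<Phi>_def card_PiE intro: finite_PiE)
  show "finite Q"
    using card\<Phi> by (simp add: Q_def)
  have "N > 0" by (simp add: N_def)
  then have "\<Phi> \<noteq> {}"
    by (auto simp: \<Phi>_def PiE_eq_empty_iff)
  then show "Q \<noteq> {}"
    by (auto simp: Q_def lessThan_empty_iff)
  fix I assume I: "I \<subseteq> S" "I \<noteq> {}"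
  have k: "0 < card I" "card I \<le> 2 ^ L"
    using I S by (auto simp: card_gt_0_iff dest: finite_subset intro: order_trans[OF card_mono])
  define l where "l = (GREATEST l. 2 * 2 ^ l * card I \<le> N)"
  have bound: "l' \<le> L + 1" if "2 * 2 ^ l' * card I \<le> N" for l'
  proof -
    have "(2::nat) ^ Suc l' \<le> 2 ^ Suc l' * card I"
      using k(1) by simp
    also have "\<dots> \<le> 2 ^ (L + 2)"
      using that by (simp add: N_def)
    finally have "Suc l' \<le> L + 2"
      by (subst (asm) power_increasing_iff) auto
    then show ?thesis by simp
  qed
  have "2 * 2 ^ 0 * card I \<le> N"
    using k(2) by (simp add: N_def)
  then have l: "2 * 2 ^ l * card I \<le> N"
    unfolding l_def by (rule GreatestI_nat) (use bound in blast)
  have "\<not> 2 * 2 ^ Suc l * card I \<le> N"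
    using Greatest_le_nat[of "\<lambda>l. 2 * 2 ^ l * card I \<le> N" "Suc l" "L + 1"] bound
    unfolding l_def[symmetric] by auto
  then have "N \<le> 4 * 2 ^ l * card I"
    by simp
  from card_functions_isolating_ge[OF S(1) I l this]
  have H: "N ^ card S \<le> 8 * card {f \<in> \<Phi>. \<exists>!s. s \<in> I \<and> f s < 2 ^ l}"
    by (simp add: \<Phi>_def)
  have "Pair l ` {f \<in> \<Phi>. \<exists>!s. s \<in> I \<and> f s < 2 ^ l} \<subseteq> {q \<in> Q. \<exists>!s. s \<in> I \<inter> Y q}"
  proof
    fix q assume "q \<in> Pair l ` {f \<in> \<Phi>. \<exists>!s. s \<in> I \<and> f s < 2 ^ l}"
    then obtain f where f: "q = (l, f)" "f \<in> \<Phi>" "\<exists>!s. s \<in> I \<and> f s < 2 ^ l" by blast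
    have "q \<in> Q"
      using f bound[OF l] by (simp add: Q_def)
    moreover have "s \<in> I \<inter> Y q \<longleftrightarrow> s \<in> I \<and> f s < 2 ^ l" for s
      using I f by (auto simp: Y_def)
    ultimately show "q \<in> {q \<in> Q. \<exists>!s. s \<in> I \<inter> Y q}"
      using f(3) by simp
  qed
  then have "card (Pair l ` {f \<in> \<Phi>. \<exists>!s. s \<in> I \<and> f s < 2 ^ l}) \<le> card {q \<in> Q. \<exists>!s. s \<in> I \<inter> Y q}"
    using \<open>finite Q\<close> by (intro card_mono) auto
  then have "card {f \<in> \<Phi>. \<exists>!s. s \<in> I \<and> f s < 2 ^ l} \<le> card {q \<in> Q. \<exists>!s. s \<in> I \<inter> Y q}"
    by (simp add: card_image inj_on_def)
  then have "N ^ card S \<le> 8 * card {q \<in> Q. \<exists>!s. s \<in> I \<inter> Y q}"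
    using H by linarith
  then have "(L + 2) * N ^ card S \<le> (L + 2) * (8 * card {q \<in> Q. \<exists>!s. s \<in> I \<inter> Y q})"
    by (rule mult_left_mono) simp
  moreover have "card Q = (L + 2) * N ^ card S"
    by (simp add: Q_def card\<Phi> card_cartesian_product)
  ultimately show "card Q \<le> 8 * (L + 2) * card {q \<in> Q. \<exists>!s. s \<in> I \<inter> Y q}"
    by (simp only: mult.assoc mult.left_commute)
qed

section \<open>Amenability and expansion\<close>

lemma finitely_additive_UN:
  fixes P :: "'g set \<Rightarrow> real"
  assumes add: "\<And>S T. S \<subseteq> C \<Longrightarrow> T \<subseteq> C \<Longrightarrow> S \<inter> T = {} \<Longrightarrow> P (S \<union> T) = P S + P T"
    and "finite K" "\<And>k. k \<in> K \<Longrightarrow> B k \<subseteq> C"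
    and "\<And>k l. k \<in> K \<Longrightarrow> l \<in> K \<Longrightarrow> k \<noteq> l \<Longrightarrow> B k \<inter> B l = {}"
  shows "P (\<Union>k\<in>K. B k) = (\<Sum>k\<in>K. P (B k))"
  using assms(2-)
proof (induction K rule: finite_induct)
  case empty
  show ?case using add[of "{}" "{}"] by simp
next
  case (insert k K)
  have "B k \<inter> (\<Union>l\<in>K. B l) = {}"
    using insert.hyps insert.prems(2) by fastforce
  then have "P (B k \<union> (\<Union>l\<in>K. B l)) = P (B k) + P (\<Union>l\<in>K. B l)"
    by (intro add) (use insert.prems(1) in auto)
  also have "P (\<Union>l\<in>K. B l) = (\<Sum>l\<in>K. P (B l))"
    by (intro insert.IH) (use insert.prems in auto)
  finally show ?case
    using insert.hyps by simp
qed

context group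
begin

text \<open>The pieces of \<open>G \<times> {..<m}\<close> on which \<open>\<phi>\<close> is a given translation have total measure \<open>m\<close>, while
their translates are disjoint in \<open>G \<times> {..<n}\<close>, whose total measure is \<open>n\<close>.\<close>

lemma amenable_piecewise_translation_le:
  assumes am: "amenable G" and S: "finite S" "S \<subseteq> carrier G"
    and inj: "inj_on \<phi> (carrier G \<times> {..<m})"
    and \<phi>: "\<And>g j. g \<in> carrier G \<Longrightarrow> j < m \<Longrightarrow> \<phi> (g, j) \<in> (\<lambda>s. s \<otimes> g) ` S \<times> {..<n::nat}"
  shows "m \<le> n"
proof -
  from am obtain P :: "'a set \<Rightarrow> real" where
    P: "(\<forall>S. S \<subseteq> carrier G \<longrightarrow> 0 \<le> P S) \<and> P (carrier G) = 1 \<and>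
      (\<forall>S T. S \<subseteq> carrier G \<longrightarrow> T \<subseteq> carrier G \<longrightarrow> S \<inter> T = {} \<longrightarrow> P (S \<union> T) = P S + P T) \<and>
      (\<forall>g \<in> carrier G. \<forall>S. S \<subseteq> carrier G \<longrightarrow> P (g <# S) = P S)"
    unfolding amenable_def by (elim exE)
  then have P1: "P (carrier G) = 1" and P0: "\<And>S. S \<subseteq> carrier G \<Longrightarrow> 0 \<le> P S"
    and Padd: "\<And>S T. S \<subseteq> carrier G \<Longrightarrow> T \<subseteq> carrier G \<Longrightarrow> S \<inter> T = {} \<Longrightarrow> P (S \<union> T) = P S + P T"
    and Pinv: "\<And>g S. g \<in> carrier G \<Longrightarrow> S \<subseteq> carrier G \<Longrightarrow> P (g <# S) = P S"
    by simp_all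
  define B where "B j s i = {g \<in> carrier G. \<phi> (g, j) = (s \<otimes> g, i)}" for j s i
  have B: "B j s i \<subseteq> carrier G" for j s i
    by (auto simp: B_def)
  have lB: "s <# B j s i \<subseteq> carrier G" if "s \<in> S" for s j i
    using S B l_coset_subset_G that by blast
  have "(\<Sum>p\<in>S \<times> {..<n}. P (B j (fst p) (snd p))) = 1" if j: "j < m" for j
  proof -
    have "P (\<Union>p\<in>S \<times> {..<n}. B j (fst p) (snd p)) = (\<Sum>p\<in>S \<times> {..<n}. P (B j (fst p) (snd p)))"
    proof (rule finitely_additive_UN[OF Padd])
      show "B j (fst p) (snd p) \<inter> B j (fst p') (snd p') = {}"
        if "p \<in> S \<times> {..<n}" "p' \<in> S \<times> {..<n}" "p \<noteq> p'" for p p'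
      proof -
        have False if g: "g \<in> B j (fst p) (snd p)" "g \<in> B j (fst p') (snd p')" for g
        proof -
          have "g \<in> carrier G" "fst p \<otimes> g = fst p' \<otimes> g" "snd p = snd p'"
            using g by (auto simp: B_def)
          then have "fst p = fst p'"
            using \<open>p \<in> _\<close> \<open>p' \<in> _\<close> S(2) by (auto simp: subset_iff)
          with \<open>snd p = snd p'\<close> \<open>p \<noteq> p'\<close> show False
            by (simp add: prod_eq_iff)
        qed
        then show ?thesis by blast
      qed
    qed (use S subsetD[OF B] in auto)
    also have "(\<Union>p\<in>S \<times> {..<n}. B j (fst p) (snd p)) = carrier G"
    proof
      show "carrier G \<subseteq> (\<Union>p\<in>S \<times> {..<n}. B j (fst p) (snd p))"
      proof
        fix g assume g: "g \<in> carrier G"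
        then obtain s i where "s \<in> S" "i < n" "\<phi> (g, j) = (s \<otimes> g, i)"
          using \<phi>[OF g j] by auto
        with g show "g \<in> (\<Union>p\<in>S \<times> {..<n}. B j (fst p) (snd p))"
          by (intro UN_I[of "(s, i)"]) (auto simp: B_def)
      qed
    qed (use B in blast)
    finally show ?thesis using P1 by simp
  qed
  then have "real m = (\<Sum>j<m. \<Sum>p\<in>S \<times> {..<n}. P (B j (fst p) (snd p)))"
    by simp
  also have "\<dots> = (\<Sum>j<m. \<Sum>s\<in>S. \<Sum>i<n. P (B j s i))"
    by (simp add: sum.cartesian_product case_prod_beta)
  also have "\<dots> = (\<Sum>j<m. \<Sum>s\<in>S. \<Sum>i<n. P (s <# B j s i))"
    using S B by (intro sum.cong refl) (simp add: Pinv subset_iff)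
  also have "\<dots> = (\<Sum>j<m. \<Sum>i<n. \<Sum>s\<in>S. P (s <# B j s i))"
    by (intro sum.cong refl sum.swap)
  also have "\<dots> = (\<Sum>i<n. \<Sum>j<m. \<Sum>s\<in>S. P (s <# B j s i))"
    by (rule sum.swap)
  also have "\<dots> = (\<Sum>i<n. \<Sum>p\<in>{..<m} \<times> S. P (snd p <# B (fst p) (snd p) i))"
    by (simp add: sum.cartesian_product case_prod_beta)
  also have "\<dots> \<le> (\<Sum>i<n. 1)"
  proof (rule sum_mono)
    fix i
    let ?U = "\<Union>p\<in>{..<m} \<times> S. snd p <# B (fst p) (snd p) i"
    have U: "?U \<subseteq> carrier G"
      using subsetD[OF lB] by auto
    have "P ?U = (\<Sum>p\<in>{..<m} \<times> S. P (snd p <# B (fst p) (snd p) i))"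
    proof (rule finitely_additive_UN[OF Padd])
      show "(snd p <# B (fst p) (snd p) i) \<inter> (snd p' <# B (fst p') (snd p') i) = {}"
        if p: "p \<in> {..<m} \<times> S" "p' \<in> {..<m} \<times> S" "p \<noteq> p'" for p p'
      proof -
        have False if x: "x \<in> snd p <# B (fst p) (snd p) i" "x \<in> snd p' <# B (fst p') (snd p') i" for x
        proof -
          obtain g where g: "g \<in> carrier G" "\<phi> (g, fst p) = (x, i)" "x = snd p \<otimes> g"
            using x(1) by (auto simp: l_coset_def B_def)
          obtain g' where g': "g' \<in> carrier G" "\<phi> (g', fst p') = (x, i)" "x = snd p' \<otimes> g'"
            using x(2) by (auto simp: l_coset_def B_def)
          have eq: "(g, fst p) = (g', fst p')"
            by (rule inj_onD[OF inj]) (use g g' p in auto)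
          then have "snd p = snd p'"
            using g g' p S(2) by (metis Pair_inject mem_Times_iff r_cancel subsetD)
          with eq p(3) show False
            by (simp add: prod_eq_iff)
        qed
        then show ?thesis by blast
      qed
    qed (use S subsetD[OF lB] in auto)
    moreover have "P ?U + P (carrier G - ?U) = 1"
      using Padd[of ?U "carrier G - ?U"] U P1 by (simp add: Un_absorb1 Int_Diff)
    then have "P ?U \<le> 1"
      using P0[of "carrier G - ?U"] by auto
    ultimately show "(\<Sum>p\<in>{..<m} \<times> S. P (snd p <# B (fst p) (snd p) i)) \<le> 1"
      by simp
  qed
  finally show ?thesis by simp
qed

text \<open>A weak form of Foelner's condition, obtained from the invariant measure through matchings: if every
\<open>F\<close> failed, Hall's condition would hold for matching \<open>(g, j)\<close> with elements of
\<open>S g \<times> {..<n}\<close>.\<close>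

lemma amenable_small_expansion:
  assumes am: "amenable G" and S: "finite S" "S \<subseteq> carrier G" and nm: "n < m"
  obtains (witness) F where "finite F" "F \<subseteq> carrier G" "n * card (S <#> F) < m * card F"
proof (rule ccontr)
  assume no: "\<not> thesis"
  have large: "m * card F \<le> n * card (S <#> F)" if "finite F" "F \<subseteq> carrier G" for F
  proof (rule ccontr)
    assume "\<not> ?thesis"
    then have "n * card (S <#> F) < m * card F" by simp
    with witness that no show False by blast
  qed
  obtain \<phi> where \<phi>: "inj_on \<phi> (carrier G \<times> {..<m})"
    "\<And>v. v \<in> carrier G \<times> {..<m} \<Longrightarrow> \<phi> v \<in> (\<lambda>s. s \<otimes> fst v) ` S \<times> {..<n}"
  proof (rule hall_locally_finite[of "carrier G \<times> {..<m}" "\<lambda>v. (\<lambda>s. s \<otimes> fst v) ` S \<times> {..<n}"])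
    fix Z assume Z: "finite Z" "Z \<subseteq> carrier G \<times> {..<m}"
    have "card Z \<le> card (fst ` Z \<times> {..<m})"
      using Z by (intro card_mono) force+
    also have "\<dots> = m * card (fst ` Z)"
      by (simp add: card_cartesian_product)
    also have "\<dots> \<le> n * card (S <#> fst ` Z)"
      using Z by (intro large) auto
    also have "\<dots> = card ((S <#> fst ` Z) \<times> {..<n})"
      by (simp add: card_cartesian_product)
    also have "(S <#> fst ` Z) \<times> {..<n} = (\<Union>v\<in>Z. (\<lambda>s. s \<otimes> fst v) ` S \<times> {..<n})"
      by (auto simp: set_mult_def)
    finally show "card Z \<le> card (\<Union>v\<in>Z. (\<lambda>s. s \<otimes> fst v) ` S \<times> {..<n})" .
  qed (use S in auto)
  have "m \<le> n"
    by (rule amenable_piecewise_translation_le[OF am S \<phi>(1)]) (use \<phi>(2) in force)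
  with nm show False by simp
qed

text \<open>The normalised counting measures of Foelner sets are finitely additive and almost invariant. All
real functions on subsets with values between 0 and 1 form a compact space for pointwise convergence,
and the required properties are closed conditions with the finite intersection property.\<close>

lemma amenableI_folner:
  assumes folner: "\<And>S \<epsilon>. finite S \<Longrightarrow> S \<subseteq> carrier G \<Longrightarrow> \<epsilon> > 0 \<Longrightarrow>
    \<exists>F. finite F \<and> F \<subseteq> carrier G \<and> real (card (S <#> F)) < (1 + \<epsilon>) * real (card F)"
  shows "amenable G"
proof -
  define K :: "('a set \<Rightarrow> real) set" where "K = Pi\<^sub>E UNIV (\<lambda>_. {0..1})"
  define prob where "prob = {P :: 'a set \<Rightarrow> real. P (carrier G) = 1 \<and>
      (\<forall>S T. S \<subseteq> carrier G \<longrightarrow> T \<subseteq> carrier G \<longrightarrow> S \<inter> T = {} \<longrightarrow> P (S \<union> T) = P S + P T)}"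
  define almost where "almost = (\<lambda>(g, n). {P :: 'a set \<Rightarrow> real.
      \<forall>S. S \<subseteq> carrier G \<longrightarrow> P (g <# S) \<le> P S + 1 / real (Suc n)})"
  have "compact K"
    using compactin_PiE[of "\<lambda>_. euclidean" UNIV "\<lambda>_::'a set. {0..1::real}"]
    by (simp add: K_def euclidean_product_topology compactin_euclidean_iff)
  have coord: "continuous_on UNIV (\<lambda>P :: 'a set \<Rightarrow> real. P S)" for S
    by (rule continuous_on_product_coordinates)
  have "closed prob"
    unfolding prob_def
    by (intro closed_Collect_conj closed_Collect_all closed_Collect_imp open_Collect_const
        closed_Collect_eq coord continuous_intros)
  have almost_closed: "closed (almost p)" for p
    unfolding almost_def case_prod_beta
    by (intro closed_Collect_all closed_Collect_imp open_Collect_const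
        closed_Collect_le coord continuous_intros)
  \<comment> \<open>Finitely many conditions of almost invariance hold for a single Foelner set.\<close>
  have nonempty: "K \<inter> (prob \<inter> (\<Inter>p\<in>W. almost p)) \<noteq> {}"
    if W: "finite W" "W \<subseteq> carrier G \<times> UNIV" for W
  proof -
    define S where "S = insert \<one> ((\<lambda>p. inv (fst p)) ` W)"
    define k where "k = Max (insert 0 (snd ` W))"
    have S: "finite S" "S \<subseteq> carrier G"
      using W by (auto simp: S_def)
    obtain F where F: "finite F" "F \<subseteq> carrier G"
      "real (card (S <#> F)) < (1 + 1 / real (Suc k)) * real (card F)"
      using folner[OF S, of "1 / real (Suc k)"] by auto
    have "card F > 0"
      using F(3) by (cases "card F") auto
    have finSF: "finite (S <#> F)"
      using S(1) F(1) by (simp add: set_mult_def)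
    have "F \<subseteq> S <#> F"
      unfolding set_mult_def S_def using F(2) by force
    define P where "P U = real (card (U \<inter> F)) / real (card F)" for U
    have "P \<in> K"
      using F(1) \<open>card F > 0\<close> by (auto simp: K_def P_def divide_le_eq_1 intro!: card_mono)
    moreover have "P \<in> prob"
    proof -
      have "P (U \<union> V) = P U + P V" if "U \<inter> V = {}" for U V
      proof -
        have "card ((U \<union> V) \<inter> F) = card (U \<inter> F) + card (V \<inter> F)"
          unfolding Int_Un_distrib2 using F(1) that by (intro card_Un_disjoint) auto
        then show ?thesis
          by (simp add: P_def add_divide_distrib)
      qed
      moreover have "P (carrier G) = 1"
        using F(2) \<open>card F > 0\<close> by (simp add: P_def Int_absorb1)
      ultimately show ?thesis
        by (simp add: prob_def)
    qed
    moreover have "P \<in> almost p" if p: "p \<in> W" for p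
    proof -
      obtain g n where gn: "p = (g, n)" "g \<in> carrier G"
        using p W(2) by blast
      have "n \<le> k"
        unfolding k_def using p gn W(1) by (intro Max_ge) force+
      have "P (g <# U) \<le> P U + 1 / real (Suc n)" if U: "U \<subseteq> carrier G" for U
      proof -
        let ?D = "(S <#> F) - F"
        have sub: "(\<lambda>x. inv g \<otimes> x) ` ((g <# U) \<inter> F) \<subseteq> (U \<inter> F) \<union> ?D"
        proof
          fix y assume "y \<in> (\<lambda>x. inv g \<otimes> x) ` ((g <# U) \<inter> F)"
          then obtain u where u: "u \<in> U" "g \<otimes> u \<in> F" "y = inv g \<otimes> (g \<otimes> u)"
            by (auto simp: l_coset_def)
          have "y = u"
            using u(1,3) U gn(2) by (auto simp: m_assoc[symmetric] subset_iff)
          moreover have "inv g \<in> S"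
            unfolding S_def using p gn(1) by force
          then have "y \<in> S <#> F"
            using u(2,3) unfolding set_mult_def by blast
          ultimately show "y \<in> (U \<inter> F) \<union> ?D"
            using u(1) by blast
        qed
        have "inj_on (\<lambda>x. inv g \<otimes> x) ((g <# U) \<inter> F)"
          using F(2) gn(2) by (intro inj_onI) (auto simp: subset_iff)
        then have "card ((g <# U) \<inter> F) = card ((\<lambda>x. inv g \<otimes> x) ` ((g <# U) \<inter> F))"
          by (simp add: card_image)
        also have "\<dots> \<le> card ((U \<inter> F) \<union> ?D)"
          using finSF F(1) sub by (intro card_mono) auto
        also have "\<dots> \<le> card (U \<inter> F) + card ?D"
          by (rule card_Un_le)
        finally have "real (card ((g <# U) \<inter> F)) \<le> real (card (U \<inter> F)) + real (card ?D)"
          by (metis of_nat_add of_nat_mono)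
        also have "real (card ?D) = real (card (S <#> F)) - real (card F)"
          using \<open>F \<subseteq> S <#> F\<close> finSF F(1) by (simp add: card_Diff_subset card_mono of_nat_diff)
        also have "\<dots> \<le> real (card F) / real (Suc k)"
          using F(3) by (simp add: algebra_simps)
        also have "\<dots> \<le> real (card F) / real (Suc n)"
          using \<open>n \<le> k\<close> by (intro divide_left_mono) auto
        finally have "P (g <# U) \<le> (real (card (U \<inter> F)) + real (card F) / real (Suc n)) / real (card F)"
          unfolding P_def by (intro divide_right_mono) auto
        also have "\<dots> = P U + 1 / real (Suc n)"
          using \<open>card F > 0\<close> by (simp add: P_def add_divide_distrib)
        finally show ?thesis .
      qed
      then show ?thesis
        by (simp add: almost_def gn(1))
    qed
    ultimately show ?thesis by blast
  qed
  have "K \<inter> \<Inter>((\<lambda>p. prob \<inter> almost p) ` (carrier G \<times> UNIV)) \<noteq> {}"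
  proof (rule compact_imp_fip[OF \<open>compact K\<close>])
    show "closed T" if "T \<in> (\<lambda>p. prob \<inter> almost p) ` (carrier G \<times> UNIV)" for T
      using that \<open>closed prob\<close> almost_closed by blast
    fix \<F> assume \<F>: "finite \<F>" "\<F> \<subseteq> (\<lambda>p. prob \<inter> almost p) ` (carrier G \<times> UNIV)"
    then obtain W where W: "W \<subseteq> carrier G \<times> UNIV" "finite W" "\<F> = (\<lambda>p. prob \<inter> almost p) ` W"
      by (meson finite_subset_image)
    show "K \<inter> \<Inter>\<F> \<noteq> {}"
      using nonempty[OF W(2,1)] unfolding W(3) by blast
  qed
  then obtain P where P: "P \<in> K" "\<And>g n. g \<in> carrier G \<Longrightarrow> P \<in> prob \<inter> almost (g, n)"
    by blast
  then have prob: "P \<in> prob"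
    using one_closed by blast
  have le: "P (g <# S) \<le> P S" if g: "g \<in> carrier G" and S: "S \<subseteq> carrier G" for g S
  proof (rule field_le_epsilon)
    fix e :: real assume "e > 0"
    then obtain n where "1 / real (Suc n) < e"
      using nat_approx_posE by blast
    moreover have "P (g <# S) \<le> P S + 1 / real (Suc n)"
      using P(2)[OF g, of n] S by (simp add: almost_def)
    ultimately show "P (g <# S) \<le> P S + e" by linarith
  qed
  have "P (g <# S) = P S" if g: "g \<in> carrier G" and S: "S \<subseteq> carrier G" for g S
  proof (rule antisym)
    have "inv g <# (g <# S) = S"
      using g S by (simp add: lcos_m_assoc lcos_mult_one)
    then show "P S \<le> P (g <# S)"
      using le[of "inv g" "g <# S"] g S by (simp add: l_coset_subset_G)
  qed (rule le[OF g S])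
  then show ?thesis
    using P(1) prob unfolding amenable_def K_def prob_def by (intro exI[of _ P]) (auto simp: PiE_iff)
qed

lemma not_amenable_expansion:
  assumes "\<not> amenable G"
  obtains S \<epsilon> where "finite S" "S \<subseteq> carrier G" "\<epsilon> > 0"
    "\<And>F. finite F \<Longrightarrow> F \<subseteq> carrier G \<Longrightarrow> (1 + \<epsilon>) * real (card F) \<le> real (card (S <#> F))"
  using amenableI_folner assms not_le by metis

lemma set_mult_card_le:
  assumes "finite S" "finite T"
  shows "card (S <#> T) \<le> card S * card T"
proof -
  have "S <#> T = (\<lambda>(s, t). s \<otimes> t) ` (S \<times> T)"
    by (auto simp: set_mult_def)
  then show ?thesis
    using card_image_le[of "S \<times> T"] assms by (simp add: card_cartesian_product)
qed

lemma expansion_power: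
  assumes S: "finite S" "S \<subseteq> carrier G"
    and exp: "\<And>F. finite F \<Longrightarrow> F \<subseteq> carrier G \<Longrightarrow> c * real (card F) \<le> real (card (S <#> F))"
    and c: "0 \<le> c"
  shows "\<exists>T. finite T \<and> T \<subseteq> carrier G \<and> card T \<le> card S ^ k \<and>
    (\<forall>F. finite F \<longrightarrow> F \<subseteq> carrier G \<longrightarrow> c ^ k * real (card F) \<le> real (card (T <#> F)))"
proof (induction k)
  case 0
  have "{\<one>} <#> F = F" if "F \<subseteq> carrier G" for F
    using that by (force simp: set_mult_def)
  then show ?case
    by (intro exI[of _ "{\<one>}"]) auto
next
  case (Suc k)
  then obtain T where T: "finite T" "T \<subseteq> carrier G" "card T \<le> card S ^ k"
    "\<And>F. finite F \<Longrightarrow> F \<subseteq> carrier G \<Longrightarrow> c ^ k * real (card F) \<le> real (card (T <#> F))"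
    by blast
  have "finite (S <#> T)"
    using S T by (simp add: set_mult_def)
  moreover have "S <#> T \<subseteq> carrier G"
    using S T set_mult_closed by blast
  moreover have "card (S <#> T) \<le> card S ^ Suc k"
    using set_mult_card_le[OF S(1) T(1)] T(3) by (simp add: order_trans)
  moreover have "c ^ Suc k * real (card F) \<le> real (card ((S <#> T) <#> F))"
    if F: "finite F" "F \<subseteq> carrier G" for F
  proof -
    have "c ^ Suc k * real (card F) \<le> c * real (card (T <#> F))"
      using T(4)[OF F] c by (simp add: mult.assoc mult_left_mono)
    also have "\<dots> \<le> real (card (S <#> (T <#> F)))"
      using T F set_mult_closed by (intro exp) (auto simp: set_mult_def)
    finally show ?thesis
      using S T F by (simp add: set_mult_assoc)
  qed
  ultimately show ?case by blast
qed

text \<open>Under taking powers of \<open>S\<close> the expansion factor grows exponentially, but the logarithm of the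
cardinality only linearly. The constants are those of \<open>isolating_family\<close>.\<close>

lemma not_amenable_logarithmic_expansion:
  assumes "\<not> amenable G"
  obtains S L where "finite S" "S \<subseteq> carrier G" "card S \<le> 2 ^ L"
    "\<And>F. finite F \<Longrightarrow> F \<subseteq> carrier G \<Longrightarrow> F \<noteq> {} \<Longrightarrow> 8 * (L + 2) * card F < card (S <#> F)"
proof -
  obtain S \<epsilon> where S: "finite S" "S \<subseteq> carrier G" "\<epsilon> > 0"
    "\<And>F. finite F \<Longrightarrow> F \<subseteq> carrier G \<Longrightarrow> (1 + \<epsilon>) * real (card F) \<le> real (card (S <#> F))"
    by (rule not_amenable_expansion[OF assms]) blast
  define s where "s = card S"
  obtain k0 where k0: "real k0 * \<epsilon>\<^sup>2 > 16 * (real s + 1)"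
    using reals_Archimedean3[of "\<epsilon>\<^sup>2"] S(3) by auto
  \<comment> \<open>The power \<open>2 * k\<close> is even so that the square of Bernoulli's linear bound \<open>k * \<epsilon>\<close> applies, which
      beats a linear function of \<open>k\<close>.\<close>
  define k where "k = Suc k0"
  obtain T where T: "finite T" "T \<subseteq> carrier G" "card T \<le> s ^ (2 * k)"
    "\<And>F. finite F \<Longrightarrow> F \<subseteq> carrier G \<Longrightarrow> (1 + \<epsilon>) ^ (2 * k) * real (card F) \<le> real (card (T <#> F))"
    using expansion_power[OF S(1,2,4), of "2 * k"] S(3) unfolding s_def by auto
  show thesis
  proof
    have "s ^ (2 * k) \<le> (2 ^ s) ^ (2 * k)"
      by (intro power_mono) (simp_all add: less_imp_le)
    also have "\<dots> = 2 ^ (2 * s * k)"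
      by (simp add: power_mult[symmetric] mult_ac)
    finally show "card T \<le> 2 ^ (2 * s * k)"
      using T(3) by linarith
    fix F assume F: "finite F" "F \<subseteq> carrier G" "F \<noteq> {}"
    have "8 * (2 * real s * real k + 2) \<le> real k * (16 * (real s + 1))"
      by (simp add: k_def algebra_simps)
    also have "\<dots> < real k * (real k0 * \<epsilon>\<^sup>2)"
      using k0 by (intro mult_strict_left_mono) (auto simp: k_def)
    also have "\<dots> \<le> real k * (real k * \<epsilon>\<^sup>2)"
      by (intro mult_left_mono mult_right_mono) (auto simp: k_def)
    also have "\<dots> = (real k * \<epsilon>)\<^sup>2"
      by (simp add: power2_eq_square)
    also have "\<dots> \<le> ((1 + \<epsilon>) ^ k)\<^sup>2"
      using Bernoulli_inequality[of \<epsilon> k] S(3) by (intro power_mono) auto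
    also have "\<dots> = (1 + \<epsilon>) ^ (2 * k)"
      by (simp add: power_mult[symmetric] mult.commute)
    finally have "8 * (2 * real s * real k + 2) * real (card F) < (1 + \<epsilon>) ^ (2 * k) * real (card F)"
      using F by (intro mult_strict_right_mono) (auto simp: card_gt_0_iff)
    also have "\<dots> \<le> real (card (T <#> F))"
      by (rule T(4)[OF F(1,2)])
    also have "8 * (2 * real s * real k + 2) * real (card F) = real (8 * (2 * s * k + 2) * card F)"
      by simp
    finally show "8 * (2 * s * k + 2) * card F < card (T <#> F)"
      by (simp only: of_nat_less_iff)
  qed (use T in auto)
qed

end

section \<open>A finite unique-neighbour relation for non-amenable groups\<close>

context group
begin

text \<open>An element \<open>(s, i, j)\<close> of \<open>T\<close> is an edge from \<open>(g, j)\<close> to \<open>(s \<otimes> g, i)\<close> for every \<open>g\<close>. The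
elements of \<open>J\<close> are points \<open>(j, e)\<close> of a grid and those of \<open>I\<close> are pairs of an index \<open>q\<close> of the
isolating family and a height; the edges labelled \<open>(s, q)\<close> exist only for \<open>s \<in> Y q\<close> and project the
grid along their own slope \<open>\<sigma> (s, q)\<close>.\<close>

lemma unique_neighbours:
  assumes "\<not> amenable G"
  obtains S :: "'a set" and I :: "((nat \<times> ('a \<Rightarrow> nat)) \<times> nat) set" and J :: "(nat \<times> nat) set"
    and T :: "('a \<times> ((nat \<times> ('a \<Rightarrow> nat)) \<times> nat) \<times> (nat \<times> nat)) set"
  where "finite S" "S \<subseteq> carrier G" "finite I" "finite J" "card I < card J"
    "\<And>E. finite E \<Longrightarrow> E \<noteq> {} \<Longrightarrow> E \<subseteq> carrier G \<times> J \<Longrightarrow>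
      \<exists>h\<in>carrier G. \<exists>i\<in>I. \<exists>s\<in>S. \<exists>j\<in>J. (s, i, j) \<in> T \<and> (inv s \<otimes> h, j) \<in> E \<and>
        (\<forall>s'\<in>S. \<forall>j'\<in>J. (s', i, j') \<in> T \<and> (inv s' \<otimes> h, j') \<in> E \<longrightarrow> s' = s \<and> j' = j)"
proof -
  obtain S L where S: "finite S" "S \<subseteq> carrier G" "card S \<le> 2 ^ L"
    and exp: "\<And>F. finite F \<Longrightarrow> F \<subseteq> carrier G \<Longrightarrow> F \<noteq> {} \<Longrightarrow> 8 * (L + 2) * card F < card (S <#> F)"
    using not_amenable_logarithmic_expansion[OF assms] by blast
  obtain Q :: "(nat \<times> ('a \<Rightarrow> nat)) set" and Y where Q: "finite Q" "Q \<noteq> {}"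
    and isol: "\<And>I. I \<subseteq> S \<Longrightarrow> I \<noteq> {} \<Longrightarrow> card Q \<le> 8 * (L + 2) * card {q \<in> Q. \<exists>!s. s \<in> I \<inter> Y q}"
    by (rule isolating_family[OF S(1,3)]) blast
  have "finite (S \<times> Q)"
    using S Q by simp
  from finite_imp_inj_to_nat_seg[OF this]
  obtain \<sigma> :: "'a \<times> nat \<times> ('a \<Rightarrow> nat) \<Rightarrow> nat" and w
    where \<sigma>: "\<sigma> ` (S \<times> Q) = {i. i < w}" "inj_on \<sigma> (S \<times> Q)"
    by blast
  \<comment> \<open>\<open>M\<close> columns suffice to exceed \<open>card Q\<close>. The projections lengthen the columns from \<open>d\<close> to at most
      \<open>d + w * M\<close>, and \<open>d\<close> is large enough to make this loss smaller than the gain of one column.\<close>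
  define M where "M = card Q + 1"
  define d where "d = card Q * (w * M) + 1"
  define I where "I = Q \<times> {..<d + w * M}"
  define J where "J = {..<M} \<times> {..<d}"
  define T where "T = {(s, (q, e'), (j, e)) | s q e' j e. s \<in> Y q \<and> e' = e + \<sigma> (s, q) * j}"
  show thesis
  proof
    show "finite S" "S \<subseteq> carrier G" by fact+
    show "finite I" "finite J"
      using Q by (auto simp: I_def J_def)
    have "card I = card Q * d + card Q * (w * M)"
      by (simp add: I_def card_cartesian_product algebra_simps)
    also have "\<dots> < card Q * d + d"
      by (simp add: d_def)
    also have "\<dots> = card J"
      by (simp add: J_def M_def card_cartesian_product)
    finally show "card I < card J" .
    fix E assume E: "finite E" "E \<noteq> {}" "E \<subseteq> carrier G \<times> J"
    define F where "F = fst ` E"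
    have F: "finite F" "F \<noteq> {}" "F \<subseteq> carrier G"
      using E by (auto simp: F_def)
    \<comment> \<open>\<open>U g\<close> collects the edge labels whose edges, started at \<open>g\<close>, meet no edge with the same \<open>q\<close>
        started at another point of \<open>F\<close>.\<close>
    define hit where "hit h = {s \<in> S. inv s \<otimes> h \<in> F}" for h
    define U where "U g = {(s, q). s \<in> S \<and> q \<in> Q \<and> hit (s \<otimes> g) \<inter> Y q = {s}}" for g
    have finU: "finite (U g)" for g
      by (rule finite_subset[OF _ \<open>finite (S \<times> Q)\<close>]) (auto simp: U_def)
    \<comment> \<open>Double counting: each \<open>h \<in> S F\<close> is isolated by a fraction of at least \<open>1 / (8 * (L + 2))\<close> of
        the indices \<open>q\<close>, and \<open>S F\<close> has more than \<open>8 * (L + 2) * card F\<close> elements.\<close>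
    have "\<exists>g\<in>F. card Q < card (U g)"
    proof (rule ccontr)
      assume "\<not> ?thesis"
      then have small: "card (U g) \<le> card Q" if "g \<in> F" for g
        using that by (simp add: not_less)
      let ?Z = "SIGMA h:S <#> F. {q \<in> Q. \<exists>!s. s \<in> hit h \<inter> Y q}"
      have finSF: "finite (S <#> F)"
        using S F by (simp add: set_mult_def)
      have "card (S <#> F) * card Q = (\<Sum>h\<in>S <#> F. card Q)"
        by simp
      also have "\<dots> \<le> (\<Sum>h\<in>S <#> F. 8 * (L + 2) * card {q \<in> Q. \<exists>!s. s \<in> hit h \<inter> Y q})"
      proof (rule sum_mono, rule isol)
        fix h assume "h \<in> S <#> F"
        then obtain s g where "s \<in> S" "g \<in> F" "h = s \<otimes> g"
          by (auto simp: set_mult_def)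
        then have "s \<in> hit h"
          using S F by (auto simp: hit_def m_assoc[symmetric] subset_iff)
        then show "hit h \<noteq> {}" by blast
      qed (auto simp: hit_def)
      also have "\<dots> = 8 * (L + 2) * card ?Z"
        using finSF Q(1) by (simp add: sum_distrib_left[symmetric] card_SigmaI)
      also have "card ?Z \<le> card ((\<lambda>(g, s, q). (s \<otimes> g, q)) ` (SIGMA g:F. U g))"
      proof (rule card_mono)
        show "finite ((\<lambda>(g, s, q). (s \<otimes> g, q)) ` (SIGMA g:F. U g))"
          using F finU by (intro finite_imageI finite_SigmaI)
        show "?Z \<subseteq> (\<lambda>(g, s, q). (s \<otimes> g, q)) ` (SIGMA g:F. U g)"
        proof
          fix z assume "z \<in> ?Z"
          then obtain h q where z: "z = (h, q)" "h \<in> S <#> F" "q \<in> Q" "\<exists>!s. s \<in> hit h \<inter> Y q"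
            by blast
          then obtain s where s: "hit h \<inter> Y q = {s}"
            by blast
          then have "s \<in> S" "inv s \<otimes> h \<in> F"
            by (auto simp: hit_def)
          moreover have "h \<in> carrier G"
            using z(2) S F set_mult_closed by blast
          then have "s \<otimes> (inv s \<otimes> h) = h"
            using \<open>s \<in> S\<close> S(2) by (auto simp: m_assoc[symmetric] subset_iff)
          ultimately show "z \<in> (\<lambda>(g, s, q). (s \<otimes> g, q)) ` (SIGMA g:F. U g)"
            using z s by (intro image_eqI[of _ _ "(inv s \<otimes> h, s, q)"]) (auto simp: U_def)
        qed
      qed
      also have "\<dots> \<le> card (SIGMA g:F. U g)"
        using F finU by (intro card_image_le finite_SigmaI)
      also have "\<dots> = (\<Sum>g\<in>F. card (U g))"
        using F finU by (simp add: card_SigmaI)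
      also have "\<dots> \<le> (\<Sum>g\<in>F. card Q)"
        by (intro sum_mono small)
      finally have "card (S <#> F) * card Q \<le> (8 * (L + 2) * card F) * card Q"
        by (simp add: mult.assoc)
      moreover have "card Q > 0"
        using Q by (simp add: card_gt_0_iff)
      ultimately have "card (S <#> F) \<le> 8 * (L + 2) * card F"
        by (metis mult_le_cancel2)
      with exp[OF F(1,3,2)] show False by simp
    qed
    then obtain g where g: "g \<in> F" "M \<le> card (U g)"
      by (auto simp: M_def)
    have Usub: "U g \<subseteq> S \<times> Q"
      by (auto simp: U_def)
    have "card (\<sigma> ` U g) = card (U g)"
      using \<sigma>(2) Usub by (intro card_image) (rule inj_on_subset)
    obtain p j e where p: "p \<in> \<sigma> ` U g" "(g, j, e) \<in> E"
      "\<And>j' e'. (g, j', e') \<in> E \<Longrightarrow> e + p * j \<le> e' + p * j' \<Longrightarrow> j' = j \<and> e' = e"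
    proof (rule unique_maximum_in_some_direction[of "{v. (g, v) \<in> E}" M "\<sigma> ` U g"])
      show "finite {v. (g, v) \<in> E}"
        by (rule finite_subset[OF _ finite_imageI[OF E(1), of snd]]) force
      show "{v. (g, v) \<in> E} \<noteq> {}"
      proof -
        obtain v where "(g, v) \<in> E"
          using g(1) unfolding F_def by force
        then show ?thesis by blast
      qed
      show "j < M" if "(j, e) \<in> {v. (g, v) \<in> E}" for j e
        using that E(3) by (auto simp: J_def)
    qed (use finU g(2) \<open>card (\<sigma> ` U g) = card (U g)\<close> in auto)
    then obtain s q where sq: "(s, q) \<in> U g" "p = \<sigma> (s, q)"
      by auto
    then have s: "s \<in> S" "q \<in> Q" "hit (s \<otimes> g) \<inter> Y q = {s}"
      by (auto simp: U_def)
    have car: "s \<in> carrier G" "g \<in> carrier G"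
      using s S g F by auto
    have J: "j < M" "e < d"
      using p(2) E(3) by (auto simp: J_def)
    have "p < w"
      using \<sigma>(1) s sq(2) by blast
    then have "p * j \<le> w * M"
      using J by (intro mult_mono) auto
    then have "(q, e + p * j) \<in> I"
      using s J by (simp add: I_def)
    moreover have "s \<otimes> g \<in> carrier G"
      using car by simp
    moreover have "(s, (q, e + p * j), (j, e)) \<in> T"
      using s(3) sq(2) by (cases q) (auto simp: T_def)
    moreover have "(inv s \<otimes> (s \<otimes> g), (j, e)) \<in> E"
      using p(2) car by (simp add: m_assoc[symmetric])
    moreover have "s' = s \<and> v' = (j, e)"
      if v': "s' \<in> S" "(s', (q, e + p * j), v') \<in> T" "(inv s' \<otimes> (s \<otimes> g), v') \<in> E" for s' v'
    proof -
      obtain j' e' where v: "v' = (j', e')" by fastforce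
      have T': "s' \<in> Y q" "e + p * j = e' + \<sigma> (s', q) * j'"
        using v'(2) by (auto simp: T_def v)
      have "s' \<in> hit (s \<otimes> g)"
        using v'(1,3) by (force simp: hit_def F_def)
      then have "s' = s"
        using s(3) T'(1) by blast
      then have "(g, j', e') \<in> E"
        using v'(3) v car by (simp add: m_assoc[symmetric])
      with p(3)[of j' e'] T'(2) \<open>s' = s\<close> sq(2) v show ?thesis
        by simp
    qed
    moreover have "(j, e) \<in> J"
      using J by (simp add: J_def)
    ultimately show "\<exists>h\<in>carrier G. \<exists>i\<in>I. \<exists>s\<in>S. \<exists>j\<in>J. (s, i, j) \<in> T \<and> (inv s \<otimes> h, j) \<in> E \<and>
        (\<forall>s'\<in>S. \<forall>j'\<in>J. (s', i, j') \<in> T \<and> (inv s' \<otimes> h, j') \<in> E \<longrightarrow> s' = s \<and> j' = j)"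
      using s(1) by blast
  qed
qed

end

section \<open>The strong rank condition as solvability of wide linear systems\<close>

definition nontrivial_kernel ::
    "('r, 'm) ring_scheme \<Rightarrow> 'i set \<Rightarrow> 'j set \<Rightarrow> ('i \<Rightarrow> 'j \<Rightarrow> 'r) \<Rightarrow> bool" where
  "nontrivial_kernel R I J M \<longleftrightarrow> (\<exists>x \<in> J \<rightarrow> carrier R.
     (\<exists>j\<in>J. x j \<noteq> \<zero>\<^bsub>R\<^esub>) \<and> (\<forall>i\<in>I. (\<Oplus>\<^bsub>R\<^esub>j\<in>J. M i j \<otimes>\<^bsub>R\<^esub> x j) = \<zero>\<^bsub>R\<^esub>))"

context abelian_monoid
begin

lemma finsum_product:
  assumes "finite I" "finite J" "f \<in> I \<times> J \<rightarrow> carrier G"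
  shows "(\<Oplus>p\<in>I \<times> J. f p) = (\<Oplus>i\<in>I. \<Oplus>j\<in>J. f (i, j))"
  using assms(1,3)
proof (induction I rule: finite_induct)
  case empty
  show ?case by simp
next
  case (insert i I)
  have f: "f (k, j) \<in> carrier G" if "k \<in> insert i I" "j \<in> J" for k j
    using insert.prems that by blast
  have "(\<Oplus>p\<in>insert i I \<times> J. f p) = (\<Oplus>p\<in>Pair i ` J \<union> I \<times> J. f p)"
    by (rule arg_cong[where f = "finsum G f"]) auto
  also have "\<dots> = (\<Oplus>p\<in>Pair i ` J. f p) \<oplus> (\<Oplus>p\<in>I \<times> J. f p)"
    using insert.hyps assms(2) f by (intro finsum_Un_disjoint) auto
  also have "(\<Oplus>p\<in>Pair i ` J. f p) = (\<Oplus>j\<in>J. f (i, j))"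
    using f by (intro finsum_reindex) (auto simp: inj_on_def)
  also have "(\<Oplus>p\<in>I \<times> J. f p) = (\<Oplus>k\<in>I. \<Oplus>j\<in>J. f (k, j))"
    using insert.prems by (intro insert.IH) auto
  finally show ?case
    using insert.hyps f by (simp add: Pi_def)
qed

lemma finsum_single_nonzero:
  assumes "finite J" "k \<in> J" "f k \<in> carrier G" "\<And>j. j \<in> J \<Longrightarrow> j \<noteq> k \<Longrightarrow> f j = \<zero>"
  shows "(\<Oplus>j\<in>J. f j) = f k"
proof -
  have "f \<in> J \<rightarrow> carrier G"
    using assms(3,4) by (metis Pi_I zero_closed)
  then have "(\<Oplus>j\<in>J. f j) = (\<Oplus>j\<in>J. if k = j then f j else \<zero>)"
    using assms by (intro add.finprod_cong') auto
  also have "\<dots> = f k"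
    using assms \<open>f \<in> J \<rightarrow> carrier G\<close> by (intro finsum_singleton) auto
  finally show ?thesis .
qed

end

context ring
begin

text \<open>Deleting columns and renumbering turns the system into a matrix \<open>R\<^sup>n\<^sup>+\<^sup>1 \<rightarrow> R\<^sup>n\<close>; a difference of two
vectors with the same image, extended by zero, is the solution.\<close>

lemma SRC_imp_nontrivial_kernel:
  assumes src: "SRC R" and fin: "finite I" "finite J" and less: "card I < card J"
    and M: "\<And>i j. i \<in> I \<Longrightarrow> j \<in> J \<Longrightarrow> M i j \<in> carrier R"
  shows "nontrivial_kernel R I J M"
proof -
  define n where "n = card I"
  obtain b where b: "bij_betw b {..<n} I"
    using ex_bij_betw_nat_finite[OF fin(1)] by (auto simp: n_def lessThan_atLeast0)
  obtain J' where J': "J' \<subseteq> J" "card J' = n + 1" "finite J'"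
    using obtain_subset_with_card_n[of "n + 1" J] less by (auto simp: n_def)
  obtain c where c: "bij_betw c {..<n + 1} J'"
    using ex_bij_betw_nat_finite[OF J'(3)] J'(2) by (auto simp: lessThan_atLeast0)
  have bI: "b i \<in> I" if "i < n" for i
    using b that by (auto simp: bij_betw_def)
  have cJ: "c j \<in> J'" if "j < n + 1" for j
    using c that by (auto simp: bij_betw_def)
  have Mc: "M (b i) (c j) \<in> carrier R" if "i < n" "j < n + 1" for i j
    using M bI cJ J' that by blast
  define f where "f x = (\<lambda>i\<in>{..<n}. \<Oplus>j\<in>{..<n + 1}. M (b i) (c j) \<otimes> x j)" for x
  have car: "x j \<in> carrier R" if "x \<in> free_carrier R (n + 1)" "j < n + 1" for x j
    using that by (auto simp: free_carrier_def PiE_iff)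
  have fcl: "(\<Oplus>j\<in>{..<n + 1}. M (b i) (c j) \<otimes> x j) \<in> carrier R"
    if "x \<in> free_carrier R (n + 1)" "i < n" for x i
    using that Mc car by (intro finsum_closed) auto
  have f_add: "f (free_add R (n + 1) x y) = free_add R n (f x) (f y)"
    if xy: "x \<in> free_carrier R (n + 1)" "y \<in> free_carrier R (n + 1)" for x y
  proof
    fix i
    have "(\<Oplus>j\<in>{..<n + 1}. M (b i) (c j) \<otimes> (x j \<oplus> y j))
        = (\<Oplus>j\<in>{..<n + 1}. M (b i) (c j) \<otimes> x j) \<oplus> (\<Oplus>j\<in>{..<n + 1}. M (b i) (c j) \<otimes> y j)"
      if "i < n"
    proof -
      have "(\<Oplus>j\<in>{..<n + 1}. M (b i) (c j) \<otimes> (x j \<oplus> y j))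
          = (\<Oplus>j\<in>{..<n + 1}. M (b i) (c j) \<otimes> x j \<oplus> M (b i) (c j) \<otimes> y j)"
        using that Mc car[OF xy(1)] car[OF xy(2)] by (intro add.finprod_cong') (auto simp: r_distr)
      also have "\<dots> = (\<Oplus>j\<in>{..<n + 1}. M (b i) (c j) \<otimes> x j) \<oplus> (\<Oplus>j\<in>{..<n + 1}. M (b i) (c j) \<otimes> y j)"
        using that Mc car[OF xy(1)] car[OF xy(2)] by (intro finsum_addf) auto
      finally show ?thesis .
    qed
    moreover have "(\<Oplus>j\<in>{..<n + 1}. M (b i) (c j) \<otimes> free_add R (n + 1) x y j)
        = (\<Oplus>j\<in>{..<n + 1}. M (b i) (c j) \<otimes> (x j \<oplus> y j))" if "i < n"
      using that Mc car[OF xy(1)] car[OF xy(2)] by (intro add.finprod_cong') (auto simp: free_add_def)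
    ultimately show "f (free_add R (n + 1) x y) i = free_add R n (f x) (f y) i"
      by (simp add: f_def free_add_def)
  qed
  have f_scale: "f (free_rscale R (n + 1) x r) = free_rscale R n (f x) r"
    if x: "x \<in> free_carrier R (n + 1)" and r: "r \<in> carrier R" for x r
  proof
    fix i
    have "(\<Oplus>j\<in>{..<n + 1}. M (b i) (c j) \<otimes> free_rscale R (n + 1) x r j)
        = (\<Oplus>j\<in>{..<n + 1}. M (b i) (c j) \<otimes> x j) \<otimes> r" if "i < n"
    proof -
      have "(\<Oplus>j\<in>{..<n + 1}. M (b i) (c j) \<otimes> free_rscale R (n + 1) x r j)
          = (\<Oplus>j\<in>{..<n + 1}. (M (b i) (c j) \<otimes> x j) \<otimes> r)"
        using that Mc car[OF x] r by (intro add.finprod_cong') (auto simp: free_rscale_def m_assoc)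
      also have "\<dots> = (\<Oplus>j\<in>{..<n + 1}. M (b i) (c j) \<otimes> x j) \<otimes> r"
        using that Mc car[OF x] r by (intro finsum_ldistr[symmetric]) auto
      finally show ?thesis .
    qed
    then show "f (free_rscale R (n + 1) x r) i = free_rscale R n (f x) r i"
      by (simp add: f_def free_rscale_def)
  qed
  have "f \<in> right_module_hom R (n + 1) n"
    unfolding right_module_hom_def
    using f_add f_scale fcl by (auto simp: f_def free_carrier_def)
  then have "\<not> inj_on f (free_carrier R (n + 1))"
    using src unfolding SRC_def by blast
  then obtain x y where xy: "x \<in> free_carrier R (n + 1)" "y \<in> free_carrier R (n + 1)" "f x = f y" "x \<noteq> y"
    by (auto simp: inj_on_def)
  define z where "z = (\<lambda>j\<in>{..<n + 1}. x j \<ominus> y j)"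
  have z: "z \<in> free_carrier R (n + 1)"
    using car[OF xy(1)] car[OF xy(2)] by (auto simp: z_def free_carrier_def)
  have "free_add R (n + 1) z y = x"
  proof
    fix j
    show "free_add R (n + 1) z y j = x j"
    proof (cases "j < n + 1")
      case True
      then show ?thesis
        using car[OF xy(1)] car[OF xy(2)] by (simp add: free_add_def z_def a_minus_def a_assoc l_neg)
    next
      case False
      then show ?thesis
        using xy(1) PiE_arb[of x "{..<n + 1}" _ j] by (simp add: free_add_def free_carrier_def)
    qed
  qed
  then have fz: "free_add R n (f z) (f y) = f y"
    using f_add[OF z xy(2)] xy(3) by simp
  have row: "(\<Oplus>j\<in>{..<n + 1}. M (b i) (c j) \<otimes> z j) = \<zero>" if "i < n" for i
  proof -
    have "f z i \<oplus> f y i = f y i"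
      using fun_cong[OF fz, of i] that by (simp add: free_add_def)
    then have "f z i = \<zero>"
      using fcl[OF z that] fcl[OF xy(2) that] that by (simp add: f_def)
    then show ?thesis
      using that by (simp add: f_def)
  qed
  obtain j0 where j0: "j0 < n + 1" "z j0 \<noteq> \<zero>"
  proof -
    obtain j where "x j \<noteq> y j"
      using xy(4) by blast
    moreover from this have "j < n + 1"
      using xy(1,2) PiE_arb[of x "{..<n + 1}" _ j] PiE_arb[of y "{..<n + 1}" _ j]
      by (fastforce simp: free_carrier_def)
    ultimately show thesis
      using that[of j] car[OF xy(1)] car[OF xy(2)] by (simp add: z_def)
  qed
  define u where "u j = (if j \<in> J' then z (inv_into {..<n + 1} c j) else \<zero>)" for j
  have uc: "u (c j) = z j" if "j < n + 1" for j
    using that cJ bij_betw_inv_into_left[OF c] by (simp add: u_def)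
  have u: "u j \<in> carrier R" for j
  proof (cases "j \<in> J'")
    case True
    then obtain k where "k < n + 1" "j = c k"
      using c by (auto simp: bij_betw_def)
    then show ?thesis
      using uc car[OF z] by simp
  qed (simp add: u_def)
  have "(\<Oplus>j\<in>J. M i j \<otimes> u j) = \<zero>" if "i \<in> I" for i
  proof -
    obtain k where k: "k < n" "i = b k"
      using b \<open>i \<in> I\<close> by (auto simp: bij_betw_def)
    have "(\<Oplus>j\<in>J. M i j \<otimes> u j) = (\<Oplus>j\<in>J'. M i j \<otimes> u j)"
      using fin J' M that u
      by (intro add.finprod_mono_neutral_cong_right) (auto simp: u_def)
    also have "\<dots> = (\<Oplus>j\<in>c ` {..<n + 1}. M i j \<otimes> u j)"
      using c by (simp add: bij_betw_def)
    also have "\<dots> = (\<Oplus>j\<in>{..<n + 1}. M i (c j) \<otimes> u (c j))"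
      using c cJ J' M that u by (intro finsum_reindex) (auto simp: bij_betw_def)
    also have "\<dots> = (\<Oplus>j\<in>{..<n + 1}. M (b k) (c j) \<otimes> z j)"
      using uc k Mc car[OF z] by (intro add.finprod_cong') auto
    also have "\<dots> = \<zero>"
      using row k by simp
    finally show ?thesis .
  qed
  moreover have "c j0 \<in> J" "u (c j0) \<noteq> \<zero>"
    using j0 cJ J' uc by auto
  ultimately show ?thesis
    unfolding nontrivial_kernel_def using u by (intro bexI[of _ u]) auto
qed

text \<open>The matrix of a module homomorphism consists of the images of the standard basis vectors \<open>e j\<close>.\<close>

lemma SRC_if_nontrivial_kernels:
  assumes ker: "\<And>(n::nat) M. (\<And>i j. i < n \<Longrightarrow> j < n + 1 \<Longrightarrow> M i j \<in> carrier R) \<Longrightarrow>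
    nontrivial_kernel R {..<n} {..<n + 1} M"
  shows "SRC R"
  unfolding SRC_def
proof (intro allI notI)
  fix n assume "\<exists>f\<in>right_module_hom R (n + 1) n. inj_on f (free_carrier R (n + 1))"
  then obtain f where f: "f \<in> right_module_hom R (n + 1) n" and inj: "inj_on f (free_carrier R (n + 1))"
    by blast
  have f_car: "f x i \<in> carrier R" if "x \<in> free_carrier R (n + 1)" "i < n" for x i
    using f that by (auto simp: right_module_hom_def free_carrier_def PiE_iff Pi_iff)
  have f_add: "f (free_add R (n + 1) x y) i = f x i \<oplus> f y i"
    if "x \<in> free_carrier R (n + 1)" "y \<in> free_carrier R (n + 1)" "i < n" for x y i
    using f that by (simp add: right_module_hom_def free_add_def)
  have f_scale: "f (free_rscale R (n + 1) x r) i = f x i \<otimes> r"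
    if "x \<in> free_carrier R (n + 1)" "r \<in> carrier R" "i < n" for x r i
    using f that by (simp add: right_module_hom_def free_rscale_def)
  define e where "e j = (\<lambda>k\<in>{..<n + 1}. if k = j then \<one> else \<zero>)" for j
  have e: "e j \<in> free_carrier R (n + 1)" for j
    by (auto simp: e_def free_carrier_def)
  have "nontrivial_kernel R {..<n} {..<n + 1} (\<lambda>i j. f (e j) i)"
    by (rule ker) (use f_car e in auto)
  then obtain x where x: "\<And>j. j < n + 1 \<Longrightarrow> x j \<in> carrier R" "\<exists>j<n + 1. x j \<noteq> \<zero>"
    "\<And>i. i < n \<Longrightarrow> (\<Oplus>j\<in>{..<n + 1}. f (e j) i \<otimes> x j) = \<zero>"
    unfolding nontrivial_kernel_def by auto
  \<comment> \<open>The truncations of \<open>x\<close>, which are built up from \<open>t 0\<close> by adding multiples of basis vectors.\<close>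
  define t where "t k = (\<lambda>j\<in>{..<n + 1}. if j < k then x j else \<zero>)" for k
  have t: "t k \<in> free_carrier R (n + 1)" for k
    using x(1) by (auto simp: t_def free_carrier_def)
  have f0: "f (t 0) i = \<zero>" if "i < n" for i
  proof -
    have "free_rscale R (n + 1) (t 0) \<zero> = t 0"
      by (auto simp: free_rscale_def t_def fun_eq_iff)
    then show ?thesis
      using f_scale[OF t _ that, of \<zero> 0] f_car[OF t that, of 0] by simp
  qed
  have partial: "k \<le> n + 1 \<Longrightarrow> f (t k) i = (\<Oplus>j\<in>{..<k}. f (e j) i \<otimes> x j)" if i: "i < n" for i k
  proof (induction k)
    case 0
    show ?case using f0[OF i] by simp
  next
    case (Suc k)
    have "free_rscale R (n + 1) (e k) (x k) \<in> free_carrier R (n + 1)"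
      using Suc.prems x(1) by (auto simp: free_rscale_def e_def free_carrier_def)
    moreover have "t (Suc k) = free_add R (n + 1) (t k) (free_rscale R (n + 1) (e k) (x k))"
      using Suc.prems x(1) by (auto simp: t_def e_def free_add_def free_rscale_def fun_eq_iff less_Suc_eq)
    ultimately have "f (t (Suc k)) i = f (t k) i \<oplus> f (e k) i \<otimes> x k"
      using f_add[OF t _ i] f_scale[OF e _ i] x(1) Suc.prems by simp
    also have "\<dots> = f (e k) i \<otimes> x k \<oplus> (\<Oplus>j\<in>{..<k}. f (e j) i \<otimes> x j)"
      using Suc x(1) f_car[OF e i] by (simp add: a_comm Pi_def)
    also have "\<dots> = (\<Oplus>j\<in>{..<Suc k}. f (e j) i \<otimes> x j)"
      using Suc.prems x(1) f_car[OF e i] by (simp add: lessThan_Suc Pi_def)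
    finally show ?case .
  qed
  have "f (t (n + 1)) = f (t 0)"
  proof
    fix i
    show "f (t (n + 1)) i = f (t 0) i"
    proof (cases "i < n")
      case True
      then show ?thesis
        using partial[OF True, of "n + 1"] x(3) f0 by simp
    next
      case False
      have "f (t k) \<in> {..<n} \<rightarrow>\<^sub>E carrier R" for k
        using f t by (auto simp: right_module_hom_def free_carrier_def Pi_iff)
      then show ?thesis
        using False by (metis PiE_arb lessThan_iff)
    qed
  qed
  then have "t (n + 1) = t 0"
    using inj t by (auto dest: inj_onD)
  then have "t (n + 1) j = t 0 j" for j
    by simp
  then have "x j = \<zero>" if "j < n + 1" for j
  proof -
    have "t (n + 1) j = x j" "t 0 j = \<zero>"
      using that by (simp_all add: t_def)
    with \<open>t (n + 1) j = t 0 j\<close> show ?thesis by simp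
  qed
  with x(2) show False by blast
qed

end

section \<open>Homogeneous parts\<close>

context graded_ring
begin

lemma component_carrier: "g \<in> carrier G \<Longrightarrow> a \<in> A g \<Longrightarrow> a \<in> carrier R"
  using additive_subgroup.a_subset[OF component_subgroup] by blast

lemma component_zero: "g \<in> carrier G \<Longrightarrow> \<zero>\<^bsub>R\<^esub> \<in> A g"
  using additive_subgroup.zero_closed[OF component_subgroup] .

lemma component_add: "g \<in> carrier G \<Longrightarrow> a \<in> A g \<Longrightarrow> b \<in> A g \<Longrightarrow> a \<oplus>\<^bsub>R\<^esub> b \<in> A g"
  using additive_subgroup.a_closed[OF component_subgroup] .

lemma component_times:
  assumes "g \<in> carrier G" "h \<in> carrier G" "a \<in> A g" "b \<in> A h"
  shows "a \<otimes>\<^bsub>R\<^esub> b \<in> A (g \<otimes>\<^bsub>G\<^esub> h)"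
  using component_mult[OF assms(1,2)] assms(3,4)
  by (auto simp: subgroup_product_def set_mult_def intro: generate.incl)

text \<open>The homogeneous part of degree \<open>g\<close>, extracted from the unique decomposition.\<close>

definition hpart :: "'r \<Rightarrow> 'g \<Rightarrow> 'r" where
  "hpart x = (THE c. c \<in> (\<Pi>\<^sub>E g \<in> carrier G. A g) \<and>
           finite {g \<in> carrier G. c g \<noteq> \<zero>\<^bsub>R\<^esub>} \<and>
           x = (\<Oplus>\<^bsub>R\<^esub> g \<in> {g \<in> carrier G. c g \<noteq> \<zero>\<^bsub>R\<^esub>}. c g))"

lemma
  assumes x: "x \<in> carrier R"
  shows hpart_in: "g \<in> carrier G \<Longrightarrow> hpart x g \<in> A g"
    and finite_support: "finite {g \<in> carrier G. hpart x g \<noteq> \<zero>\<^bsub>R\<^esub>}"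
    and sum_support: "(\<Oplus>\<^bsub>R\<^esub>g\<in>{g \<in> carrier G. hpart x g \<noteq> \<zero>\<^bsub>R\<^esub>}. hpart x g) = x"
  using theI'[OF direct_sum[OF x], folded hpart_def] by (auto simp: PiE_iff)

lemma hpart_carrier: "x \<in> carrier R \<Longrightarrow> g \<in> carrier G \<Longrightarrow> hpart x g \<in> carrier R"
  using hpart_in component_carrier by blast

lemma hpart_eqI:
  assumes F: "finite F" "F \<subseteq> carrier G" and c: "\<And>g. g \<in> F \<Longrightarrow> c g \<in> A g"
    and x: "x = (\<Oplus>\<^bsub>R\<^esub>g\<in>F. c g)" and h: "h \<in> carrier G"
  shows "hpart x h = (if h \<in> F then c h else \<zero>\<^bsub>R\<^esub>)"
proof -
  define d where "d = (\<lambda>g\<in>carrier G. if g \<in> F then c g else \<zero>\<^bsub>R\<^esub>)"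
  have cc: "c g \<in> carrier R" if "g \<in> F" for g
    using c that F(2) component_carrier by blast
  have "{g \<in> carrier G. d g \<noteq> \<zero>\<^bsub>R\<^esub>} \<subseteq> F"
    by (auto simp: d_def)
  moreover have "(\<Oplus>\<^bsub>R\<^esub>g\<in>F. c g) = (\<Oplus>\<^bsub>R\<^esub>g\<in>{g \<in> carrier G. d g \<noteq> \<zero>\<^bsub>R\<^esub>}. d g)"
    using F cc by (intro R.add.finprod_mono_neutral_cong_right) (auto simp: d_def)
  moreover have "d \<in> (\<Pi>\<^sub>E g \<in> carrier G. A g)"
    using c component_zero by (auto simp: d_def)
  ultimately have "d \<in> (\<Pi>\<^sub>E g \<in> carrier G. A g) \<and> finite {g \<in> carrier G. d g \<noteq> \<zero>\<^bsub>R\<^esub>} \<and>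
      x = (\<Oplus>\<^bsub>R\<^esub> g \<in> {g \<in> carrier G. d g \<noteq> \<zero>\<^bsub>R\<^esub>}. d g)"
    using x F(1) finite_subset by auto
  moreover have "x \<in> carrier R"
    using x cc by (auto intro!: R.finsum_closed)
  ultimately have "hpart x = d"
    unfolding hpart_def by (intro the1_equality direct_sum)
  then show ?thesis
    using h by (simp add: d_def)
qed

lemma hpart_homogeneous:
  assumes "k \<in> carrier G" "a \<in> A k" "h \<in> carrier G"
  shows "hpart a h = (if h = k then a else \<zero>\<^bsub>R\<^esub>)"
  using hpart_eqI[of "{k}" "\<lambda>_. a" a h] assms component_carrier[OF assms(1,2)] by auto

lemma hpart_zero: "h \<in> carrier G \<Longrightarrow> hpart \<zero>\<^bsub>R\<^esub> h = \<zero>\<^bsub>R\<^esub>"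
  using hpart_eqI[of "{}" "\<lambda>_. \<zero>\<^bsub>R\<^esub>"] by simp

lemma hpart_add:
  assumes x: "x \<in> carrier R" and y: "y \<in> carrier R" and h: "h \<in> carrier G"
  shows "hpart (x \<oplus>\<^bsub>R\<^esub> y) h = hpart x h \<oplus>\<^bsub>R\<^esub> hpart y h"
proof -
  define F where "F = {g \<in> carrier G. hpart x g \<noteq> \<zero>\<^bsub>R\<^esub>} \<union> {g \<in> carrier G. hpart y g \<noteq> \<zero>\<^bsub>R\<^esub>}"
  have F: "finite F" "F \<subseteq> carrier G"
    using finite_support x y by (auto simp: F_def)
  have *: "z = (\<Oplus>\<^bsub>R\<^esub>g\<in>F. hpart z g)" if "z = x \<or> z = y" for z
  proof -
    have z: "z \<in> carrier R" using that x y by auto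
    have "(\<Oplus>\<^bsub>R\<^esub>g\<in>F. hpart z g) = (\<Oplus>\<^bsub>R\<^esub>g\<in>{g \<in> carrier G. hpart z g \<noteq> \<zero>\<^bsub>R\<^esub>}. hpart z g)"
      using F that hpart_carrier[OF z]
      by (intro R.add.finprod_mono_neutral_cong_right) (auto simp: F_def)
    then show ?thesis
      using sum_support[OF z] by simp
  qed
  have "hpart (x \<oplus>\<^bsub>R\<^esub> y) h = (if h \<in> F then hpart x h \<oplus>\<^bsub>R\<^esub> hpart y h else \<zero>\<^bsub>R\<^esub>)"
  proof (rule hpart_eqI[OF F _ _ h])
    show "x \<oplus>\<^bsub>R\<^esub> y = (\<Oplus>\<^bsub>R\<^esub>g\<in>F. hpart x g \<oplus>\<^bsub>R\<^esub> hpart y g)"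
      using *[of x] *[of y] F(2) hpart_carrier x y by (subst R.finsum_addf) (auto simp: subset_iff)
  qed (use F(2) hpart_in x y component_add in auto)
  moreover have "hpart x h = \<zero>\<^bsub>R\<^esub> \<and> hpart y h = \<zero>\<^bsub>R\<^esub>" if "h \<notin> F"
    using that h by (auto simp: F_def)
  ultimately show ?thesis by auto
qed

lemma hpart_finsum:
  assumes f: "\<And>j. j \<in> J \<Longrightarrow> f j \<in> carrier R" and h: "h \<in> carrier G"
  shows "hpart (\<Oplus>\<^bsub>R\<^esub>j\<in>J. f j) h = (\<Oplus>\<^bsub>R\<^esub>j\<in>J. hpart (f j) h)"
  using f
proof (induction J rule: infinite_finite_induct)
  case (insert j J)
  then show ?case
    using h hpart_carrier by (simp add: Pi_def hpart_add)
qed (use h in \<open>auto simp: hpart_zero\<close>)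

lemma graded_induct:
  assumes x: "x \<in> carrier R"
    and hom: "\<And>g a. g \<in> carrier G \<Longrightarrow> a \<in> A g \<Longrightarrow> P a"
    and add: "\<And>y z. y \<in> carrier R \<Longrightarrow> z \<in> carrier R \<Longrightarrow> P y \<Longrightarrow> P z \<Longrightarrow> P (y \<oplus>\<^bsub>R\<^esub> z)"
  shows "P x"
proof -
  have "P (\<Oplus>\<^bsub>R\<^esub>g\<in>F. hpart x g)" if "finite F" "F \<subseteq> carrier G" for F
    using that
  proof (induction F rule: finite_induct)
    case empty
    show ?case
      using hom[OF G.one_closed component_zero[OF G.one_closed]] by simp
  next
    case (insert g F)
    have car: "hpart x k \<in> carrier R" if "k \<in> insert g F" for k
      using that insert.prems hpart_carrier[OF x] by blast
    have "P (hpart x g \<oplus>\<^bsub>R\<^esub> (\<Oplus>\<^bsub>R\<^esub>g\<in>F. hpart x g))"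
      using insert car hom[OF _ hpart_in[OF x], of g] by (intro add) (auto intro!: R.finsum_closed)
    then show ?case
      using insert.hyps car by (simp add: Pi_def)
  qed
  from this[OF finite_support[OF x]] sum_support[OF x] show ?thesis by auto
qed

lemma hpart_mult_right:
  assumes x: "x \<in> carrier R" and b: "g \<in> carrier G" "b \<in> A g" and h: "h \<in> carrier G"
  shows "hpart (x \<otimes>\<^bsub>R\<^esub> b) h = hpart x (h \<otimes>\<^bsub>G\<^esub> inv\<^bsub>G\<^esub> g) \<otimes>\<^bsub>R\<^esub> b"
proof (rule graded_induct[OF x])
  fix k a assume k: "k \<in> carrier G" "a \<in> A k"
  have "h = k \<otimes>\<^bsub>G\<^esub> g \<longleftrightarrow> h \<otimes>\<^bsub>G\<^esub> inv\<^bsub>G\<^esub> g = k"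
    using k b h by (metis G.inv_solve_right')
  then show "hpart (a \<otimes>\<^bsub>R\<^esub> b) h = hpart a (h \<otimes>\<^bsub>G\<^esub> inv\<^bsub>G\<^esub> g) \<otimes>\<^bsub>R\<^esub> b"
    using hpart_homogeneous[OF _ component_times[OF k(1) b(1) k(2) b(2)] h]
      hpart_homogeneous[OF k, of "h \<otimes>\<^bsub>G\<^esub> inv\<^bsub>G\<^esub> g"] k b h component_carrier[OF b] by simp
next
  fix y z assume "y \<in> carrier R" "z \<in> carrier R"
    "hpart (y \<otimes>\<^bsub>R\<^esub> b) h = hpart y (h \<otimes>\<^bsub>G\<^esub> inv\<^bsub>G\<^esub> g) \<otimes>\<^bsub>R\<^esub> b"
    "hpart (z \<otimes>\<^bsub>R\<^esub> b) h = hpart z (h \<otimes>\<^bsub>G\<^esub> inv\<^bsub>G\<^esub> g) \<otimes>\<^bsub>R\<^esub> b"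
  then show "hpart ((y \<oplus>\<^bsub>R\<^esub> z) \<otimes>\<^bsub>R\<^esub> b) h = hpart (y \<oplus>\<^bsub>R\<^esub> z) (h \<otimes>\<^bsub>G\<^esub> inv\<^bsub>G\<^esub> g) \<otimes>\<^bsub>R\<^esub> b"
    using b h component_carrier[OF b] hpart_carrier by (simp add: R.l_distr hpart_add)
qed

lemma hpart_mult_left:
  assumes x: "x \<in> carrier R" and a: "g \<in> carrier G" "a \<in> A g" and h: "h \<in> carrier G"
  shows "hpart (a \<otimes>\<^bsub>R\<^esub> x) h = a \<otimes>\<^bsub>R\<^esub> hpart x (inv\<^bsub>G\<^esub> g \<otimes>\<^bsub>G\<^esub> h)"
proof (rule graded_induct[OF x])
  fix k b assume k: "k \<in> carrier G" "b \<in> A k"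
  have "h = g \<otimes>\<^bsub>G\<^esub> k \<longleftrightarrow> inv\<^bsub>G\<^esub> g \<otimes>\<^bsub>G\<^esub> h = k"
    using k a h by (metis G.inv_solve_left')
  then show "hpart (a \<otimes>\<^bsub>R\<^esub> b) h = a \<otimes>\<^bsub>R\<^esub> hpart b (inv\<^bsub>G\<^esub> g \<otimes>\<^bsub>G\<^esub> h)"
    using hpart_homogeneous[OF _ component_times[OF a(1) k(1) a(2) k(2)] h]
      hpart_homogeneous[OF k, of "inv\<^bsub>G\<^esub> g \<otimes>\<^bsub>G\<^esub> h"] k a h component_carrier[OF a] by simp
next
  fix y z assume "y \<in> carrier R" "z \<in> carrier R"
    "hpart (a \<otimes>\<^bsub>R\<^esub> y) h = a \<otimes>\<^bsub>R\<^esub> hpart y (inv\<^bsub>G\<^esub> g \<otimes>\<^bsub>G\<^esub> h)"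
    "hpart (a \<otimes>\<^bsub>R\<^esub> z) h = a \<otimes>\<^bsub>R\<^esub> hpart z (inv\<^bsub>G\<^esub> g \<otimes>\<^bsub>G\<^esub> h)"
  then show "hpart (a \<otimes>\<^bsub>R\<^esub> (y \<oplus>\<^bsub>R\<^esub> z)) h = a \<otimes>\<^bsub>R\<^esub> hpart (y \<oplus>\<^bsub>R\<^esub> z) (inv\<^bsub>G\<^esub> g \<otimes>\<^bsub>G\<^esub> h)"
    using a h component_carrier[OF a] hpart_carrier by (simp add: R.r_distr hpart_add)
qed

lemma nonzero_hpart:
  assumes "x \<in> carrier R" "x \<noteq> \<zero>\<^bsub>R\<^esub>"
  obtains g where "g \<in> carrier G" "hpart x g \<noteq> \<zero>\<^bsub>R\<^esub>"
proof (rule ccontr)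
  assume "\<not> thesis"
  then have none: "{g \<in> carrier G. hpart x g \<noteq> \<zero>\<^bsub>R\<^esub>} = {}"
    using that by blast
  show False
    using sum_support[OF assms(1)] assms(2) unfolding none by simp
qed

end

section \<open>Strongly graded rings over a domain\<close>

locale strongly_graded_over_domain = strongly_graded_ring +
  assumes base_domain: "noncommutative_domain (base_ring G R A)"
begin

abbreviation B where "B \<equiv> base_ring G R A"

sublocale B: noncommutative_domain B
  by (rule base_domain)

lemma B_simps [simp]:
  "carrier B = A \<one>\<^bsub>G\<^esub>" "x \<otimes>\<^bsub>B\<^esub> y = x \<otimes>\<^bsub>R\<^esub> y"
  "x \<oplus>\<^bsub>B\<^esub> y = x \<oplus>\<^bsub>R\<^esub> y" "\<one>\<^bsub>B\<^esub> = \<one>\<^bsub>R\<^esub>" "\<zero>\<^bsub>B\<^esub> = \<zero>\<^bsub>R\<^esub>"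
  by (simp_all add: base_ring_def)

lemma one_in_base: "\<one>\<^bsub>R\<^esub> \<in> A \<one>\<^bsub>G\<^esub>"
  using B.one_closed by simp

lemma B_finsum:
  assumes "\<And>j. j \<in> J \<Longrightarrow> f j \<in> A \<one>\<^bsub>G\<^esub>"
  shows "(\<Oplus>\<^bsub>B\<^esub>j\<in>J. f j) = (\<Oplus>\<^bsub>R\<^esub>j\<in>J. f j)"
  using assms
proof (induction J rule: infinite_finite_induct)
  case (insert j J)
  have "(\<Oplus>\<^bsub>B\<^esub>j\<in>insert j J. f j) = f j \<oplus>\<^bsub>R\<^esub> (\<Oplus>\<^bsub>B\<^esub>j\<in>J. f j)"
    using insert.hyps insert.prems by (subst B.finsum_insert) auto
  also have "\<dots> = (\<Oplus>\<^bsub>R\<^esub>j\<in>insert j J. f j)"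
    using insert component_carrier[OF G.one_closed] by (simp add: Pi_def)
  finally show ?case .
qed auto

lemma component_subset_if_products:
  assumes g: "g \<in> carrier G" "h \<in> carrier G" and H: "additive_subgroup H R"
    and prod: "\<And>u v. u \<in> A g \<Longrightarrow> v \<in> A h \<Longrightarrow> u \<otimes>\<^bsub>R\<^esub> v \<in> H"
  shows "A (g \<otimes>\<^bsub>G\<^esub> h) \<subseteq> H"
proof -
  have "subgroup_product R (A g) (A h) \<subseteq> H"
    unfolding subgroup_product_def
  proof (rule R.add.generate_subgroup_incl)
    show "A g <#>\<^bsub>R\<^esub> A h \<subseteq> H"
      using prod by (auto simp: set_mult_def)
    show "subgroup H (add_monoid R)"
      using H by (rule additive_subgroup.a_subgroup)
  qed
  then show ?thesis
    using component_mult_eq[OF g] by simp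
qed

text \<open>If \<open>A g\<close> killed \<open>a\<close>, so would the products of \<open>A (inv g)\<close> and \<open>A g\<close>, which by strong grading
span the component of the identity; but this component contains \<open>\<one>\<close>.\<close>

lemma nonzero_left_mult:
  assumes a: "a \<in> carrier R" "a \<noteq> \<zero>\<^bsub>R\<^esub>" and g: "g \<in> carrier G"
  obtains (witness) u where "u \<in> A g" "u \<otimes>\<^bsub>R\<^esub> a \<noteq> \<zero>\<^bsub>R\<^esub>"
proof (rule ccontr)
  assume "\<not> thesis"
  then have kill: "u \<otimes>\<^bsub>R\<^esub> a = \<zero>\<^bsub>R\<^esub>" if "u \<in> A g" for u
    using witness[OF that] by blast
  have "A (inv\<^bsub>G\<^esub> g \<otimes>\<^bsub>G\<^esub> g) \<subseteq> {r \<in> carrier R. r \<otimes>\<^bsub>R\<^esub> a = \<zero>\<^bsub>R\<^esub>}"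
  proof (rule component_subset_if_products)
    show "additive_subgroup {r \<in> carrier R. r \<otimes>\<^bsub>R\<^esub> a = \<zero>\<^bsub>R\<^esub>} R"
      using a(1) by (intro additive_subgroupI R.add.subgroupI)
        (auto simp: R.l_distr R.l_minus a_inv_def[symmetric])
  next
    fix u v assume "u \<in> A (inv\<^bsub>G\<^esub> g)" "v \<in> A g"
    moreover from this have "u \<in> carrier R" "v \<in> carrier R"
      using component_carrier[OF g] component_carrier[OF G.inv_closed[OF g]] by simp_all
    ultimately show "u \<otimes>\<^bsub>R\<^esub> v \<in> {r \<in> carrier R. r \<otimes>\<^bsub>R\<^esub> a = \<zero>\<^bsub>R\<^esub>}"
      using a(1) kill by (simp add: R.m_assoc)
  qed (use g in auto)
  then have "\<one>\<^bsub>R\<^esub> \<otimes>\<^bsub>R\<^esub> a = \<zero>\<^bsub>R\<^esub>"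
    using g one_in_base by auto
  with a show False by simp
qed

lemma nonzero_right_mult:
  assumes a: "a \<in> carrier R" "a \<noteq> \<zero>\<^bsub>R\<^esub>" and g: "g \<in> carrier G"
  obtains (witness) u where "u \<in> A g" "a \<otimes>\<^bsub>R\<^esub> u \<noteq> \<zero>\<^bsub>R\<^esub>"
proof (rule ccontr)
  assume "\<not> thesis"
  then have kill: "a \<otimes>\<^bsub>R\<^esub> u = \<zero>\<^bsub>R\<^esub>" if "u \<in> A g" for u
    using witness[OF that] by blast
  have "A (g \<otimes>\<^bsub>G\<^esub> inv\<^bsub>G\<^esub> g) \<subseteq> {r \<in> carrier R. a \<otimes>\<^bsub>R\<^esub> r = \<zero>\<^bsub>R\<^esub>}"
  proof (rule component_subset_if_products)
    show "additive_subgroup {r \<in> carrier R. a \<otimes>\<^bsub>R\<^esub> r = \<zero>\<^bsub>R\<^esub>} R"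
      using a(1) by (intro additive_subgroupI R.add.subgroupI)
        (auto simp: R.r_distr R.r_minus a_inv_def[symmetric])
  next
    fix u v assume "u \<in> A g" "v \<in> A (inv\<^bsub>G\<^esub> g)"
    moreover from this have "u \<in> carrier R" "v \<in> carrier R"
      using component_carrier[OF g] component_carrier[OF G.inv_closed[OF g]] by simp_all
    ultimately show "u \<otimes>\<^bsub>R\<^esub> v \<in> {r \<in> carrier R. a \<otimes>\<^bsub>R\<^esub> r = \<zero>\<^bsub>R\<^esub>}"
      using a(1) kill by (simp add: R.m_assoc[symmetric])
  qed (use g in auto)
  then have "a \<otimes>\<^bsub>R\<^esub> \<one>\<^bsub>R\<^esub> = \<zero>\<^bsub>R\<^esub>"
    using g one_in_base by auto
  with a show False by simp
qed

text \<open>Nonzero multiples \<open>u \<otimes> a\<close> and \<open>b \<otimes> v\<close> can be found in the base ring, which is a domain.\<close>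

lemma homogeneous_no_zero_divisors:
  assumes g: "g \<in> carrier G" "a \<in> A g" "a \<noteq> \<zero>\<^bsub>R\<^esub>" and h: "h \<in> carrier G" "b \<in> A h" "b \<noteq> \<zero>\<^bsub>R\<^esub>"
  shows "a \<otimes>\<^bsub>R\<^esub> b \<noteq> \<zero>\<^bsub>R\<^esub>"
proof
  assume ab: "a \<otimes>\<^bsub>R\<^esub> b = \<zero>\<^bsub>R\<^esub>"
  have car: "a \<in> carrier R" "b \<in> carrier R"
    using component_carrier g h by auto
  obtain u where u: "u \<in> A (inv\<^bsub>G\<^esub> g)" "u \<otimes>\<^bsub>R\<^esub> a \<noteq> \<zero>\<^bsub>R\<^esub>"
    by (rule nonzero_left_mult[OF car(1) g(3) G.inv_closed[OF g(1)]])
  obtain v where v: "v \<in> A (inv\<^bsub>G\<^esub> h)" "b \<otimes>\<^bsub>R\<^esub> v \<noteq> \<zero>\<^bsub>R\<^esub>"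
    by (rule nonzero_right_mult[OF car(2) h(3) G.inv_closed[OF h(1)]])
  have uv: "u \<in> carrier R" "v \<in> carrier R"
    using component_carrier[OF G.inv_closed[OF g(1)] u(1)] component_carrier[OF G.inv_closed[OF h(1)] v(1)]
    by simp_all
  have "u \<otimes>\<^bsub>R\<^esub> a \<in> A \<one>\<^bsub>G\<^esub>" "b \<otimes>\<^bsub>R\<^esub> v \<in> A \<one>\<^bsub>G\<^esub>"
    using component_times[of "inv\<^bsub>G\<^esub> g" g u a] component_times[of h "inv\<^bsub>G\<^esub> h" b v] g h u v by auto
  moreover have "(u \<otimes>\<^bsub>R\<^esub> a) \<otimes>\<^bsub>R\<^esub> (b \<otimes>\<^bsub>R\<^esub> v) = u \<otimes>\<^bsub>R\<^esub> (a \<otimes>\<^bsub>R\<^esub> b) \<otimes>\<^bsub>R\<^esub> v"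
    using car uv by (simp add: R.m_assoc)
  then have "(u \<otimes>\<^bsub>R\<^esub> a) \<otimes>\<^bsub>R\<^esub> (b \<otimes>\<^bsub>R\<^esub> v) = \<zero>\<^bsub>R\<^esub>"
    using ab uv by simp
  ultimately show False
    using B.integral[of "u \<otimes>\<^bsub>R\<^esub> a" "b \<otimes>\<^bsub>R\<^esub> v"] u v by simp
qed

text \<open>Multiplication by \<open>rep g\<close> embeds a component into another one; this replaces the homogeneous
units of a crossed product, which a strongly graded ring may lack.\<close>

definition rep :: "'a \<Rightarrow> 'c" where
  "rep g = (SOME u. u \<in> A g \<and> u \<noteq> \<zero>\<^bsub>R\<^esub>)"

lemma rep: "g \<in> carrier G \<Longrightarrow> rep g \<in> A g" "g \<in> carrier G \<Longrightarrow> rep g \<noteq> \<zero>\<^bsub>R\<^esub>"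
proof -
  have "\<exists>u. u \<in> A g \<and> u \<noteq> \<zero>\<^bsub>R\<^esub>" if g: "g \<in> carrier G"
  proof -
    have "\<one>\<^bsub>R\<^esub> \<noteq> \<zero>\<^bsub>R\<^esub>"
      using B.one_not_zero by simp
    then obtain u where u: "u \<in> A g" "u \<otimes>\<^bsub>R\<^esub> \<one>\<^bsub>R\<^esub> \<noteq> \<zero>\<^bsub>R\<^esub>"
      using nonzero_left_mult[OF R.one_closed _ g] by blast
    then show ?thesis
      using component_carrier[OF g] by auto
  qed
  then show "g \<in> carrier G \<Longrightarrow> rep g \<in> A g" "g \<in> carrier G \<Longrightarrow> rep g \<noteq> \<zero>\<^bsub>R\<^esub>"
    unfolding rep_def by (metis (mono_tags, lifting) someI_ex)+
qed

text \<open>Taking parts of one degree commutes with multiplication by matrices over the base ring.\<close>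

lemma SRC_base:
  assumes "SRC R"
  shows "SRC B"
proof (rule B.SRC_if_nontrivial_kernels)
  fix n :: nat and M assume M: "\<And>i j. i < n \<Longrightarrow> j < n + 1 \<Longrightarrow> M i j \<in> carrier B"
  have MR: "M i j \<in> carrier R" if "i < n" "j < n + 1" for i j
    using M[OF that] component_carrier by auto
  have "nontrivial_kernel R {..<n} {..<n + 1} M"
    by (rule R.SRC_imp_nontrivial_kernel[OF assms]) (use MR in auto)
  then obtain x j0 where x: "\<And>j. j < n + 1 \<Longrightarrow> x j \<in> carrier R" and j0: "j0 < n + 1" "x j0 \<noteq> \<zero>\<^bsub>R\<^esub>"
    and row: "\<And>i. i < n \<Longrightarrow> (\<Oplus>\<^bsub>R\<^esub>j\<in>{..<n + 1}. M i j \<otimes>\<^bsub>R\<^esub> x j) = \<zero>\<^bsub>R\<^esub>"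
    unfolding nontrivial_kernel_def by auto
  obtain g where g: "g \<in> carrier G" "hpart (x j0) g \<noteq> \<zero>\<^bsub>R\<^esub>"
    using nonzero_hpart[OF x[OF j0(1)] j0(2)] by blast
  obtain v where v: "v \<in> A (inv\<^bsub>G\<^esub> g)" "hpart (x j0) g \<otimes>\<^bsub>R\<^esub> v \<noteq> \<zero>\<^bsub>R\<^esub>"
    using nonzero_right_mult[OF hpart_carrier[OF x[OF j0(1)] g(1)] g(2), of "inv\<^bsub>G\<^esub> g"] g(1) by auto
  have vR: "v \<in> carrier R"
    by (rule component_carrier[OF G.inv_closed[OF g(1)] v(1)])
  define y where "y j = hpart (x j) g \<otimes>\<^bsub>R\<^esub> v" for j
  have y: "y j \<in> A \<one>\<^bsub>G\<^esub>" if "j < n + 1" for j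
    using component_times[OF g(1) _ hpart_in[OF x[OF that] g(1)] v(1)] g(1) by (simp add: y_def)
  have "(\<Oplus>\<^bsub>B\<^esub>j\<in>{..<n + 1}. M i j \<otimes>\<^bsub>B\<^esub> y j) = \<zero>\<^bsub>B\<^esub>" if i: "i < n" for i
  proof -
    have "(\<Oplus>\<^bsub>B\<^esub>j\<in>{..<n + 1}. M i j \<otimes>\<^bsub>B\<^esub> y j) = (\<Oplus>\<^bsub>R\<^esub>j\<in>{..<n + 1}. M i j \<otimes>\<^bsub>R\<^esub> y j)"
      using B.m_closed[OF M[OF i]] y by (subst B_finsum) auto
    also have "\<dots> = (\<Oplus>\<^bsub>R\<^esub>j\<in>{..<n + 1}. hpart (M i j \<otimes>\<^bsub>R\<^esub> x j) g \<otimes>\<^bsub>R\<^esub> v)"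
    proof (rule R.add.finprod_cong')
      fix j assume j: "j \<in> {..<n + 1}"
      have "hpart (M i j \<otimes>\<^bsub>R\<^esub> x j) g = M i j \<otimes>\<^bsub>R\<^esub> hpart (x j) g"
        using hpart_mult_left[OF x G.one_closed _ g(1), of j "M i j"] M[OF i, of j] j g(1) by simp
      then show "M i j \<otimes>\<^bsub>R\<^esub> y j = hpart (M i j \<otimes>\<^bsub>R\<^esub> x j) g \<otimes>\<^bsub>R\<^esub> v"
        using MR[OF i] hpart_carrier[OF x g(1)] vR j by (simp add: y_def R.m_assoc)
    qed (use MR[OF i] x hpart_carrier[OF _ g(1)] vR in auto)
    also have "\<dots> = (\<Oplus>\<^bsub>R\<^esub>j\<in>{..<n + 1}. hpart (M i j \<otimes>\<^bsub>R\<^esub> x j) g) \<otimes>\<^bsub>R\<^esub> v"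
      using MR[OF i] x hpart_carrier[OF _ g(1)] vR by (intro R.finsum_ldistr[symmetric]) auto
    also have "(\<Oplus>\<^bsub>R\<^esub>j\<in>{..<n + 1}. hpart (M i j \<otimes>\<^bsub>R\<^esub> x j) g)
        = hpart (\<Oplus>\<^bsub>R\<^esub>j\<in>{..<n + 1}. M i j \<otimes>\<^bsub>R\<^esub> x j) g"
      using MR[OF i] x g(1) by (intro hpart_finsum[symmetric]) auto
    also have "\<dots> = \<zero>\<^bsub>R\<^esub>"
      using row[OF i] g(1) by (simp add: hpart_zero)
    finally show ?thesis
      using vR by simp
  qed
  then show "nontrivial_kernel B {..<n} {..<n + 1} M"
    unfolding nontrivial_kernel_def using y j0(1) v(2) by (intro bexI[of _ y]) (auto simp: y_def)
qed

text \<open>The matrix with entries \<open>\<Oplus>s. rep s\<close>, summed over the edges \<open>(s, i, j) \<in> T\<close>, is injective: the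
support of a nonzero vector has a unique neighbour \<open>(h, i)\<close>, so the part of degree \<open>h\<close> of row \<open>i\<close> is
a product of two nonzero homogeneous elements.\<close>

lemma SRC_imp_amenable:
  assumes src: "SRC R"
  shows "amenable G"
proof (rule ccontr)
  assume "\<not> amenable G"
  then obtain S :: "'a set" and I :: "((nat \<times> ('a \<Rightarrow> nat)) \<times> nat) set" and J :: "(nat \<times> nat) set" and T
    where S: "finite S" "S \<subseteq> carrier G" and IJ: "finite I" "finite J" "card I < card J"
      and un: "\<And>E. finite E \<Longrightarrow> E \<noteq> {} \<Longrightarrow> E \<subseteq> carrier G \<times> J \<Longrightarrow>
        \<exists>h\<in>carrier G. \<exists>i\<in>I. \<exists>s\<in>S. \<exists>j\<in>J. (s, i, j) \<in> T \<and> (inv\<^bsub>G\<^esub> s \<otimes>\<^bsub>G\<^esub> h, j) \<in> E \<and>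
          (\<forall>s'\<in>S. \<forall>j'\<in>J. (s', i, j') \<in> T \<and> (inv\<^bsub>G\<^esub> s' \<otimes>\<^bsub>G\<^esub> h, j') \<in> E \<longrightarrow> s' = s \<and> j' = j)"
    by (rule G.unique_neighbours) blast
  have tR: "rep s \<in> carrier R" if "s \<in> S" for s
    using rep(1) component_carrier S(2) that by blast
  define M where "M i j = (\<Oplus>\<^bsub>R\<^esub>s\<in>{s \<in> S. (s, i, j) \<in> T}. rep s)" for i j
  have M: "M i j \<in> carrier R" for i j
    unfolding M_def using tR by (intro R.finsum_closed) auto
  have "nontrivial_kernel R I J M"
    by (rule R.SRC_imp_nontrivial_kernel[OF src IJ M])
  then obtain x where x: "\<And>j. j \<in> J \<Longrightarrow> x j \<in> carrier R" and nz: "\<exists>j\<in>J. x j \<noteq> \<zero>\<^bsub>R\<^esub>"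
    and row: "\<And>i. i \<in> I \<Longrightarrow> (\<Oplus>\<^bsub>R\<^esub>j\<in>J. M i j \<otimes>\<^bsub>R\<^esub> x j) = \<zero>\<^bsub>R\<^esub>"
    unfolding nontrivial_kernel_def by blast
  define E where "E = (\<Union>j\<in>J. {g \<in> carrier G. hpart (x j) g \<noteq> \<zero>\<^bsub>R\<^esub>} \<times> {j})"
  have "finite E"
    unfolding E_def using IJ(2) finite_support[OF x] by (intro finite_UN_I finite_cartesian_product) auto
  moreover have "E \<noteq> {}"
  proof -
    obtain j where j: "j \<in> J" "x j \<noteq> \<zero>\<^bsub>R\<^esub>"
      using nz by blast
    obtain g where "g \<in> carrier G" "hpart (x j) g \<noteq> \<zero>\<^bsub>R\<^esub>"
      by (rule nonzero_hpart[OF x[OF j(1)] j(2)])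
    with j(1) show ?thesis by (auto simp: E_def)
  qed
  moreover have "E \<subseteq> carrier G \<times> J"
    by (auto simp: E_def)
  ultimately obtain h i s j where h: "h \<in> carrier G" "i \<in> I" and sj: "s \<in> S" "j \<in> J" "(s, i, j) \<in> T"
    "(inv\<^bsub>G\<^esub> s \<otimes>\<^bsub>G\<^esub> h, j) \<in> E"
    and uniq: "\<And>s' j'. s' \<in> S \<Longrightarrow> j' \<in> J \<Longrightarrow> (s', i, j') \<in> T \<Longrightarrow> (inv\<^bsub>G\<^esub> s' \<otimes>\<^bsub>G\<^esub> h, j') \<in> E \<Longrightarrow> s' = s \<and> j' = j"
    using un[of E] by blast
  have inv: "inv\<^bsub>G\<^esub> s' \<otimes>\<^bsub>G\<^esub> h \<in> carrier G" if "s' \<in> S" for s'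
    using h(1) S(2) that by blast
  have summand: "rep s' \<otimes>\<^bsub>R\<^esub> hpart (x j') (inv\<^bsub>G\<^esub> s' \<otimes>\<^bsub>G\<^esub> h) \<in> carrier R" if "s' \<in> S" "j' \<in> J" for s' j'
    using tR[OF that(1)] hpart_carrier[OF x[OF that(2)] inv[OF that(1)]] by simp
  have vanish: "rep s' \<otimes>\<^bsub>R\<^esub> hpart (x j') (inv\<^bsub>G\<^esub> s' \<otimes>\<^bsub>G\<^esub> h) = \<zero>\<^bsub>R\<^esub>"
    if "s' \<in> S" "(s', i, j') \<in> T" "j' \<in> J" "\<not> (s' = s \<and> j' = j)" for s' j'
  proof -
    have "(inv\<^bsub>G\<^esub> s' \<otimes>\<^bsub>G\<^esub> h, j') \<notin> E"
      using uniq that by blast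
    then have "hpart (x j') (inv\<^bsub>G\<^esub> s' \<otimes>\<^bsub>G\<^esub> h) = \<zero>\<^bsub>R\<^esub>"
      using inv[OF that(1)] that(3) by (auto simp: E_def)
    then show ?thesis
      using tR[OF that(1)] by simp
  qed
  have entry: "hpart (M i j' \<otimes>\<^bsub>R\<^esub> x j') h
      = (\<Oplus>\<^bsub>R\<^esub>s'\<in>{s' \<in> S. (s', i, j') \<in> T}. rep s' \<otimes>\<^bsub>R\<^esub> hpart (x j') (inv\<^bsub>G\<^esub> s' \<otimes>\<^bsub>G\<^esub> h))"
    if j': "j' \<in> J" for j'
  proof -
    have "M i j' \<otimes>\<^bsub>R\<^esub> x j' = (\<Oplus>\<^bsub>R\<^esub>s'\<in>{s' \<in> S. (s', i, j') \<in> T}. rep s' \<otimes>\<^bsub>R\<^esub> x j')"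
      unfolding M_def using S(1) x[OF j'] tR by (intro R.finsum_ldistr) auto
    then have "hpart (M i j' \<otimes>\<^bsub>R\<^esub> x j') h
        = hpart (\<Oplus>\<^bsub>R\<^esub>s'\<in>{s' \<in> S. (s', i, j') \<in> T}. rep s' \<otimes>\<^bsub>R\<^esub> x j') h"
      by simp
    also have "\<dots> = (\<Oplus>\<^bsub>R\<^esub>s'\<in>{s' \<in> S. (s', i, j') \<in> T}. hpart (rep s' \<otimes>\<^bsub>R\<^esub> x j') h)"
      using x[OF j'] tR h(1) by (intro hpart_finsum) auto
    also have "\<dots> = (\<Oplus>\<^bsub>R\<^esub>s'\<in>{s' \<in> S. (s', i, j') \<in> T}. rep s' \<otimes>\<^bsub>R\<^esub> hpart (x j') (inv\<^bsub>G\<^esub> s' \<otimes>\<^bsub>G\<^esub> h))"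
      using summand[OF _ j'] hpart_mult_left[OF x[OF j'] _ rep(1) h(1)] S(2)
      by (intro R.add.finprod_cong') auto
    finally show ?thesis .
  qed
  have "\<zero>\<^bsub>R\<^esub> = hpart (\<Oplus>\<^bsub>R\<^esub>j'\<in>J. M i j' \<otimes>\<^bsub>R\<^esub> x j') h"
    using row[OF h(2)] hpart_zero[OF h(1)] by simp
  also have "\<dots> = (\<Oplus>\<^bsub>R\<^esub>j'\<in>J. hpart (M i j' \<otimes>\<^bsub>R\<^esub> x j') h)"
    using M x h(1) by (intro hpart_finsum) auto
  also have "\<dots> = hpart (M i j \<otimes>\<^bsub>R\<^esub> x j) h"
  proof (rule R.finsum_single_nonzero[OF IJ(2) sj(2)])
    show "hpart (M i j \<otimes>\<^bsub>R\<^esub> x j) h \<in> carrier R"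
      using M x[OF sj(2)] h(1) by (intro hpart_carrier) auto
    fix j' assume j': "j' \<in> J" "j' \<noteq> j"
    show "hpart (M i j' \<otimes>\<^bsub>R\<^esub> x j') h = \<zero>\<^bsub>R\<^esub>"
      unfolding entry[OF j'(1)] using vanish j' by (intro R.add.finprod_one_eqI) auto
  qed
  also have "\<dots> = rep s \<otimes>\<^bsub>R\<^esub> hpart (x j) (inv\<^bsub>G\<^esub> s \<otimes>\<^bsub>G\<^esub> h)"
    unfolding entry[OF sj(2)]
    using S(1) sj summand[OF sj(1,2)] vanish by (intro R.finsum_single_nonzero) auto
  finally have "rep s \<otimes>\<^bsub>R\<^esub> hpart (x j) (inv\<^bsub>G\<^esub> s \<otimes>\<^bsub>G\<^esub> h) = \<zero>\<^bsub>R\<^esub>" ..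
  moreover have "hpart (x j) (inv\<^bsub>G\<^esub> s \<otimes>\<^bsub>G\<^esub> h) \<noteq> \<zero>\<^bsub>R\<^esub>"
    using sj(4) by (auto simp: E_def)
  moreover have "s \<in> carrier G"
    using S(2) sj(1) by blast
  ultimately show False
    using homogeneous_no_zero_divisors[OF _ rep(1) rep(2) inv[OF sj(1)] hpart_in[OF x[OF sj(2)] inv[OF sj(1)]]]
    by blast
qed

text \<open>The unknowns \<open>x j = (\<Oplus>g\<in>F. rep g \<otimes> y (j, g))\<close> involve \<open>(n + 1) * card F\<close> elements of the base ring.
Row \<open>i\<close> of the product has parts only in the degrees \<open>h \<in> S F\<close>, and multiplying such a part by
\<open>rep (inv h)\<close> turns its vanishing into one equation over the base ring.\<close>

lemma SRC_if_base_and_amenable: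
  assumes src: "SRC B" and am: "amenable G"
  shows "SRC R"
proof (rule R.SRC_if_nontrivial_kernels)
  fix n :: nat and M assume M: "\<And>i j. i < n \<Longrightarrow> j < n + 1 \<Longrightarrow> M i j \<in> carrier R"
  define S where "S = (\<Union>i<n. \<Union>j<n + 1. {g \<in> carrier G. hpart (M i j) g \<noteq> \<zero>\<^bsub>R\<^esub>})"
  have S: "finite S" "S \<subseteq> carrier G"
    unfolding S_def using finite_support[OF M] by auto
  obtain F where F: "finite F" "F \<subseteq> carrier G"
    and small: "n * card (S <#>\<^bsub>G\<^esub> F) < (n + 1) * card F"
    using G.amenable_small_expansion[OF am S, of n "n + 1"] by auto
  define SF where "SF = S <#>\<^bsub>G\<^esub> F"
  have SF: "finite SF" "SF \<subseteq> carrier G"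
    using S F G.set_mult_closed unfolding SF_def by (auto simp: set_mult_def)
  have tR: "rep g \<in> carrier R" if "g \<in> carrier G" for g
    using rep(1) component_carrier that by blast
  let ?I = "{..<n} \<times> SF" and ?J = "{..<n + 1} \<times> F"
  \<comment> \<open>\<open>N\<close> is the matrix of the system over the base ring: its entry takes the \<open>g\<close>-part of unknown
      \<open>j\<close> to the \<open>h\<close>-part of row \<open>i\<close>.\<close>
  define m where "m i j h g = hpart (M i j) (h \<otimes>\<^bsub>G\<^esub> inv\<^bsub>G\<^esub> g)" for i j h g
  have m: "m i j h g \<in> A (h \<otimes>\<^bsub>G\<^esub> inv\<^bsub>G\<^esub> g)" "m i j h g \<in> carrier R"
    if "i < n" "j < n + 1" "h \<in> carrier G" "g \<in> carrier G" for i j h g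
    using hpart_in[OF M[OF that(1,2)]] hpart_carrier[OF M[OF that(1,2)]] that(3,4) by (auto simp: m_def)
  define N where "N p q = rep (inv\<^bsub>G\<^esub> snd p) \<otimes>\<^bsub>R\<^esub> (m (fst p) (fst q) (snd p) (snd q) \<otimes>\<^bsub>R\<^esub> rep (snd q))" for p q
  have N: "N p q \<in> carrier B" if p: "p \<in> ?I" and q: "q \<in> ?J" for p q
  proof -
    have c: "fst p < n" "fst q < n + 1" "snd p \<in> carrier G" "snd q \<in> carrier G"
      using p q SF F by auto
    have "m (fst p) (fst q) (snd p) (snd q) \<otimes>\<^bsub>R\<^esub> rep (snd q)
        \<in> A (snd p \<otimes>\<^bsub>G\<^esub> inv\<^bsub>G\<^esub> snd q \<otimes>\<^bsub>G\<^esub> snd q)"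
      using m(1)[OF c] rep(1) c by (intro component_times) auto
    then have "m (fst p) (fst q) (snd p) (snd q) \<otimes>\<^bsub>R\<^esub> rep (snd q) \<in> A (snd p)"
      using c by (simp add: G.m_assoc)
    then have "N p q \<in> A (inv\<^bsub>G\<^esub> snd p \<otimes>\<^bsub>G\<^esub> snd p)"
      unfolding N_def using c rep(1) by (intro component_times) auto
    then show ?thesis
      using c by simp
  qed
  have "nontrivial_kernel B ?I ?J N"
  proof (rule B.SRC_imp_nontrivial_kernel[OF src])
    show "card ?I < card ?J"
      using small by (simp add: SF_def card_cartesian_product)
  qed (use SF F N in auto)
  then obtain y where y: "y \<in> ?J \<rightarrow> A \<one>\<^bsub>G\<^esub>" and nz: "\<exists>q\<in>?J. y q \<noteq> \<zero>\<^bsub>R\<^esub>"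
    and row: "\<And>p. p \<in> ?I \<Longrightarrow> (\<Oplus>\<^bsub>B\<^esub>q\<in>?J. N p q \<otimes>\<^bsub>B\<^esub> y q) = \<zero>\<^bsub>R\<^esub>"
    unfolding nontrivial_kernel_def by auto
  have yA: "y (j, g) \<in> A \<one>\<^bsub>G\<^esub>" "y (j, g) \<in> carrier R" if "j < n + 1" "g \<in> F" for j g
    using y that component_carrier[OF G.one_closed] by auto
  define a where "a j g = rep g \<otimes>\<^bsub>R\<^esub> y (j, g)" for j g
  have a: "a j g \<in> A g" "a j g \<in> carrier R" if "j < n + 1" "g \<in> F" for j g
  proof -
    have g: "g \<in> carrier G"
      using that F(2) by blast
    show "a j g \<in> A g"
      using component_times[OF g G.one_closed rep(1)[OF g] yA(1)[OF that]] g by (simp add: a_def)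
    then show "a j g \<in> carrier R"
      by (rule component_carrier[OF g])
  qed
  define x where "x j = (\<Oplus>\<^bsub>R\<^esub>g\<in>F. a j g)" for j
  have x: "x j \<in> carrier R" if "j < n + 1" for j
    unfolding x_def using a[OF that] by (intro R.finsum_closed) auto
  obtain j0 g0 where j0: "j0 < n + 1" "g0 \<in> F" "y (j0, g0) \<noteq> \<zero>\<^bsub>R\<^esub>"
    using nz by auto
  have "x j0 \<noteq> \<zero>\<^bsub>R\<^esub>"
  proof
    assume "x j0 = \<zero>\<^bsub>R\<^esub>"
    have g0: "g0 \<in> carrier G"
      using j0 F by blast
    have "hpart (x j0) g0 = a j0 g0"
      using hpart_eqI[OF F, of "a j0" "x j0" g0] a[OF j0(1)] g0 j0(2) by (simp add: x_def)
    then have "a j0 g0 = \<zero>\<^bsub>R\<^esub>"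
      using \<open>x j0 = \<zero>\<^bsub>R\<^esub>\<close> hpart_zero[OF g0] by simp
    then show False
      using homogeneous_no_zero_divisors[OF g0 rep(1)[OF g0] rep(2)[OF g0] G.one_closed yA(1)[OF j0(1,2)] j0(3)]
      by (simp add: a_def)
  qed
  moreover have "(\<Oplus>\<^bsub>R\<^esub>j\<in>{..<n + 1}. M i j \<otimes>\<^bsub>R\<^esub> x j) = \<zero>\<^bsub>R\<^esub>" if i: "i < n" for i
  proof -
    let ?z = "\<Oplus>\<^bsub>R\<^esub>j\<in>{..<n + 1}. M i j \<otimes>\<^bsub>R\<^esub> x j"
    have zR: "?z \<in> carrier R"
      using M[OF i] x by (intro R.finsum_closed) auto
    have part: "hpart ?z h = (\<Oplus>\<^bsub>R\<^esub>q\<in>?J. m i (fst q) h (snd q) \<otimes>\<^bsub>R\<^esub> a (fst q) (snd q))"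
      if h: "h \<in> carrier G" for h
    proof -
      have ma: "m i j h g \<otimes>\<^bsub>R\<^esub> a j g \<in> carrier R" if "j < n + 1" "g \<in> F" for j g
        using m(2)[OF i that(1) h, of g] a(2)[OF that] that(2) F(2) by blast
      have "hpart ?z h = (\<Oplus>\<^bsub>R\<^esub>j\<in>{..<n + 1}. hpart (M i j \<otimes>\<^bsub>R\<^esub> x j) h)"
        using M[OF i] x h by (intro hpart_finsum) auto
      also have "\<dots> = (\<Oplus>\<^bsub>R\<^esub>j\<in>{..<n + 1}. \<Oplus>\<^bsub>R\<^esub>g\<in>F. m i j h g \<otimes>\<^bsub>R\<^esub> a j g)"
      proof (rule R.add.finprod_cong')
        fix j assume "j \<in> {..<n + 1}"
        then have j: "j < n + 1" by simp
        have "M i j \<otimes>\<^bsub>R\<^esub> x j = (\<Oplus>\<^bsub>R\<^esub>g\<in>F. M i j \<otimes>\<^bsub>R\<^esub> a j g)"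
          unfolding x_def using F(1) M[OF i j] a[OF j] by (intro R.finsum_rdistr) auto
        then have "hpart (M i j \<otimes>\<^bsub>R\<^esub> x j) h = hpart (\<Oplus>\<^bsub>R\<^esub>g\<in>F. M i j \<otimes>\<^bsub>R\<^esub> a j g) h"
          by simp
        also have "\<dots> = (\<Oplus>\<^bsub>R\<^esub>g\<in>F. hpart (M i j \<otimes>\<^bsub>R\<^esub> a j g) h)"
          using M[OF i j] a[OF j] h by (intro hpart_finsum) auto
        also have "\<dots> = (\<Oplus>\<^bsub>R\<^esub>g\<in>F. m i j h g \<otimes>\<^bsub>R\<^esub> a j g)"
          using ma[OF j] hpart_mult_right[OF M[OF i j] _ a(1)[OF j] h] F(2)
          by (intro R.add.finprod_cong') (auto simp: m_def)
        finally show "hpart (M i j \<otimes>\<^bsub>R\<^esub> x j) h = (\<Oplus>\<^bsub>R\<^esub>g\<in>F. m i j h g \<otimes>\<^bsub>R\<^esub> a j g)" .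
      qed (use ma in auto)
      also have "\<dots> = (\<Oplus>\<^bsub>R\<^esub>q\<in>?J. m i (fst q) h (snd q) \<otimes>\<^bsub>R\<^esub> a (fst q) (snd q))"
        using F(1) ma by (subst R.finsum_product) auto
      finally show ?thesis .
    qed
    have "hpart ?z h = \<zero>\<^bsub>R\<^esub>" if h: "h \<in> carrier G" for h
    proof (cases "h \<in> SF")
      case False
      have "m i j h g = \<zero>\<^bsub>R\<^esub>" if jg: "j < n + 1" "g \<in> F" for j g
      proof (rule ccontr)
        assume "m i j h g \<noteq> \<zero>\<^bsub>R\<^esub>"
        then have "h \<otimes>\<^bsub>G\<^esub> inv\<^bsub>G\<^esub> g \<in> S"
          using i jg h F(2) unfolding S_def m_def by auto
        then have "(h \<otimes>\<^bsub>G\<^esub> inv\<^bsub>G\<^esub> g) \<otimes>\<^bsub>G\<^esub> g \<in> SF"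
          using jg(2) unfolding SF_def set_mult_def by blast
        moreover have "(h \<otimes>\<^bsub>G\<^esub> inv\<^bsub>G\<^esub> g) \<otimes>\<^bsub>G\<^esub> g = h"
          using h jg(2) F(2) by (auto simp: G.m_assoc subset_iff)
        ultimately show False
          using False by simp
      qed
      then show ?thesis
        unfolding part[OF h] using a by (intro R.add.finprod_one_eqI) auto
    next
      case True
      have p: "(i, h) \<in> ?I"
        using i True by simp
      have hi: "inv\<^bsub>G\<^esub> h \<in> carrier G"
        using h by simp
      have "rep (inv\<^bsub>G\<^esub> h) \<otimes>\<^bsub>R\<^esub> hpart ?z h
          = (\<Oplus>\<^bsub>R\<^esub>q\<in>?J. rep (inv\<^bsub>G\<^esub> h) \<otimes>\<^bsub>R\<^esub> (m i (fst q) h (snd q) \<otimes>\<^bsub>R\<^esub> a (fst q) (snd q)))"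
        unfolding part[OF h] using F a(2) tR[OF hi] m(2)[OF i _ h]
        by (intro R.finsum_rdistr) (auto simp: subset_iff)
      also have "\<dots> = (\<Oplus>\<^bsub>R\<^esub>q\<in>?J. N (i, h) q \<otimes>\<^bsub>R\<^esub> y q)"
      proof (rule R.add.finprod_cong')
        fix q assume q: "q \<in> ?J"
        then obtain j g where jg: "q = (j, g)" "j < n + 1" "g \<in> F" by auto
        have g: "g \<in> carrier G"
          using jg F by blast
        show "rep (inv\<^bsub>G\<^esub> h) \<otimes>\<^bsub>R\<^esub> (m i (fst q) h (snd q) \<otimes>\<^bsub>R\<^esub> a (fst q) (snd q)) = N (i, h) q \<otimes>\<^bsub>R\<^esub> y q"
          using tR[OF hi] tR[OF g] m(2)[OF i jg(2) h g] yA(2)[OF jg(2,3)]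
          by (simp add: N_def a_def jg(1) R.m_assoc)
      next
        show "(\<lambda>q. N (i, h) q \<otimes>\<^bsub>R\<^esub> y q) \<in> ?J \<rightarrow> carrier R"
          using N[OF p] yA(2) component_carrier[OF G.one_closed] by auto
      qed simp
      also have "\<dots> = (\<Oplus>\<^bsub>B\<^esub>q\<in>?J. N (i, h) q \<otimes>\<^bsub>B\<^esub> y q)"
      proof (subst B_finsum)
        show "N (i, h) q \<otimes>\<^bsub>B\<^esub> y q \<in> A \<one>\<^bsub>G\<^esub>" if "q \<in> ?J" for q
          using B.m_closed[OF N[OF p that], of "y q"] funcset_mem[OF y that] by simp
      qed simp
      also have "\<dots> = \<zero>\<^bsub>R\<^esub>"
        by (rule row[OF p])
      finally show ?thesis
        using homogeneous_no_zero_divisors[OF hi rep(1)[OF hi] rep(2)[OF hi] h hpart_in[OF zR h]] by blast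
    qed
    then show ?thesis
      using nonzero_hpart[OF zR] by blast
  qed
  ultimately show "nontrivial_kernel R {..<n} {..<n + 1} M"
    unfolding nontrivial_kernel_def using x j0(1) by (intro bexI[of _ x]) auto
qed

lemma SRC_iff: "SRC R \<longleftrightarrow> SRC B \<and> amenable G"
  using SRC_base SRC_imp_amenable SRC_if_base_and_amenable by blast

end

section \<open>Passage to the opposite ring\<close>

definition opposite_ring :: "('r, 'm) ring_scheme \<Rightarrow> ('r, 'm) ring_scheme" where
  "opposite_ring R = R\<lparr>monoid.mult := (\<lambda>x y. y \<otimes>\<^bsub>R\<^esub> x)\<rparr>"

lemma opposite_ring_simps [simp]:
  "carrier (opposite_ring R) = carrier R" "x \<otimes>\<^bsub>opposite_ring R\<^esub> y = y \<otimes>\<^bsub>R\<^esub> x"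
  "(\<oplus>\<^bsub>opposite_ring R\<^esub>) = (\<oplus>\<^bsub>R\<^esub>)" "\<one>\<^bsub>opposite_ring R\<^esub> = \<one>\<^bsub>R\<^esub>" "\<zero>\<^bsub>opposite_ring R\<^esub> = \<zero>\<^bsub>R\<^esub>"
  by (simp_all add: opposite_ring_def)

lemma finsum_opposite_ring [simp]: "finsum (opposite_ring R) = finsum R"
  by (simp add: fun_eq_iff finsum_def)

lemma ring_opposite_ring:
  assumes "ring R"
  shows "ring (opposite_ring R)"
proof -
  interpret ring R by fact
  show ?thesis
  proof (rule ringI)
    show "abelian_group (opposite_ring R)"
      using is_abelian_group
      by (simp add: abelian_group_def abelian_group_axioms_def abelian_monoid_def)
    show "monoid (opposite_ring R)"
      by (rule monoidI) (auto simp: m_assoc)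
  qed (auto simp: l_distr r_distr)
qed

lemma SRC_opposite_ring: "SRC (opposite_ring R) \<longleftrightarrow> LSRC R"
proof -
  have "right_module_hom (opposite_ring R) m n = left_module_hom R m n" for m n
    by (simp add: right_module_hom_def left_module_hom_def free_carrier_def free_add_def
        free_rscale_def free_lscale_def)
  then show ?thesis
    by (simp add: SRC_def LSRC_def free_carrier_def)
qed

context strongly_graded_over_domain
begin

lemma base_ring_opposite:
  "base_ring G (opposite_ring R) (\<lambda>g. A (inv\<^bsub>G\<^esub> g)) = opposite_ring B"
  by (simp add: base_ring_def opposite_ring_def)

text \<open>Reversing products requires inverting degrees, because \<open>inv (g \<otimes> h) = inv h \<otimes> inv g\<close>; in this way the
group itself need not be replaced by its opposite.\<close>

lemma opposite_graded:
  "strongly_graded_over_domain G (opposite_ring R) (\<lambda>g. A (inv\<^bsub>G\<^esub> g))"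
proof -
  have product: "subgroup_product (opposite_ring R) (A (inv\<^bsub>G\<^esub> g)) (A (inv\<^bsub>G\<^esub> h)) = A (inv\<^bsub>G\<^esub> (g \<otimes>\<^bsub>G\<^esub> h))"
    if "g \<in> carrier G" "h \<in> carrier G" for g h
  proof -
    have "A (inv\<^bsub>G\<^esub> g) <#>\<^bsub>opposite_ring R\<^esub> A (inv\<^bsub>G\<^esub> h) = A (inv\<^bsub>G\<^esub> h) <#>\<^bsub>R\<^esub> A (inv\<^bsub>G\<^esub> g)"
      by (auto simp: set_mult_def)
    then have "subgroup_product (opposite_ring R) (A (inv\<^bsub>G\<^esub> g)) (A (inv\<^bsub>G\<^esub> h))
        = subgroup_product R (A (inv\<^bsub>G\<^esub> h)) (A (inv\<^bsub>G\<^esub> g))"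
      by (simp add: subgroup_product_def)
    then show ?thesis
      using that component_mult_eq[of "inv\<^bsub>G\<^esub> h" "inv\<^bsub>G\<^esub> g"] by (simp add: G.inv_mult_group)
  qed
  interpret R': ring "opposite_ring R"
    by (rule ring_opposite_ring) (rule R.ring_axioms)
  show ?thesis
  proof (intro strongly_graded_over_domain.intro strongly_graded_over_domain_axioms.intro
      strongly_graded_ring.intro strongly_graded_ring_axioms.intro graded_ring.intro graded_ring_axioms.intro)
    show "group G" "ring (opposite_ring R)"
      by unfold_locales
    show "noncommutative_domain (base_ring G (opposite_ring R) (\<lambda>g. A (inv\<^bsub>G\<^esub> g)))"
      unfolding base_ring_opposite
    proof (intro noncommutative_domain.intro noncommutative_domain_axioms.intro)
      show "ring (opposite_ring B)"
        by (rule ring_opposite_ring) (rule B.ring_axioms)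
      show "\<one>\<^bsub>opposite_ring B\<^esub> \<noteq> \<zero>\<^bsub>opposite_ring B\<^esub>"
        using B.one_not_zero by simp
      show "a = \<zero>\<^bsub>opposite_ring B\<^esub> \<or> b = \<zero>\<^bsub>opposite_ring B\<^esub>"
        if "a \<in> carrier (opposite_ring B)" "b \<in> carrier (opposite_ring B)"
          "a \<otimes>\<^bsub>opposite_ring B\<^esub> b = \<zero>\<^bsub>opposite_ring B\<^esub>" for a b
        using B.integral[of b a] that by auto
    qed
    fix g h assume g: "g \<in> carrier G"
    show "additive_subgroup (A (inv\<^bsub>G\<^esub> g)) (opposite_ring R)"
      using component_subgroup[OF G.inv_closed[OF g]] by (simp add: additive_subgroup_def)
    assume h: "h \<in> carrier G"
    show "subgroup_product (opposite_ring R) (A (inv\<^bsub>G\<^esub> g)) (A (inv\<^bsub>G\<^esub> h)) \<subseteq> A (inv\<^bsub>G\<^esub> (g \<otimes>\<^bsub>G\<^esub> h))"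
      using product[OF g h] by simp
    show "subgroup_product (opposite_ring R) (A (inv\<^bsub>G\<^esub> g)) (A (inv\<^bsub>G\<^esub> h)) = A (inv\<^bsub>G\<^esub> (g \<otimes>\<^bsub>G\<^esub> h))"
      by (rule product[OF g h])
  next
    fix x assume "x \<in> carrier (opposite_ring R)"
    then have x: "x \<in> carrier R" by simp
    let ?P = "\<lambda>c. c \<in> (\<Pi>\<^sub>E g\<in>carrier G. A (inv\<^bsub>G\<^esub> g)) \<and> finite {g \<in> carrier G. c g \<noteq> \<zero>\<^bsub>R\<^esub>} \<and>
      x = (\<Oplus>\<^bsub>R\<^esub>g\<in>{g \<in> carrier G. c g \<noteq> \<zero>\<^bsub>R\<^esub>}. c g)"
    define d where "d = (\<lambda>g\<in>carrier G. hpart x (inv\<^bsub>G\<^esub> g))"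
    have inj: "inj_on (\<lambda>g. inv\<^bsub>G\<^esub> g) (carrier G)"
      by (rule inj_onI) (metis G.inv_inv)
    have "?P d"
    proof (intro conjI)
      show "d \<in> (\<Pi>\<^sub>E g\<in>carrier G. A (inv\<^bsub>G\<^esub> g))"
        using hpart_in[OF x] by (auto simp: d_def)
      have supp: "{g \<in> carrier G. d g \<noteq> \<zero>\<^bsub>R\<^esub>} = (\<lambda>g. inv\<^bsub>G\<^esub> g) ` {g \<in> carrier G. hpart x g \<noteq> \<zero>\<^bsub>R\<^esub>}"
      proof (intro equalityI subsetI)
        fix g assume "g \<in> {g \<in> carrier G. d g \<noteq> \<zero>\<^bsub>R\<^esub>}"
        then show "g \<in> (\<lambda>g. inv\<^bsub>G\<^esub> g) ` {g \<in> carrier G. hpart x g \<noteq> \<zero>\<^bsub>R\<^esub>}"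
          by (intro image_eqI[of _ _ "inv\<^bsub>G\<^esub> g"]) (auto simp: d_def)
      qed (auto simp: d_def)
      show "finite {g \<in> carrier G. d g \<noteq> \<zero>\<^bsub>R\<^esub>}"
        unfolding supp using finite_support[OF x] by simp
      have "(\<Oplus>\<^bsub>R\<^esub>g\<in>{g \<in> carrier G. d g \<noteq> \<zero>\<^bsub>R\<^esub>}. d g)
          = (\<Oplus>\<^bsub>R\<^esub>g\<in>{g \<in> carrier G. hpart x g \<noteq> \<zero>\<^bsub>R\<^esub>}. d (inv\<^bsub>G\<^esub> g))"
        unfolding supp
        by (rule R.finsum_reindex) (use inj hpart_carrier[OF x] in \<open>auto simp: d_def inj_on_def\<close>)
      also have "\<dots> = (\<Oplus>\<^bsub>R\<^esub>g\<in>{g \<in> carrier G. hpart x g \<noteq> \<zero>\<^bsub>R\<^esub>}. hpart x g)"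
        using hpart_carrier[OF x] by (intro R.add.finprod_cong') (auto simp: d_def)
      finally show "x = (\<Oplus>\<^bsub>R\<^esub>g\<in>{g \<in> carrier G. d g \<noteq> \<zero>\<^bsub>R\<^esub>}. d g)"
        using sum_support[OF x] by simp
    qed
    moreover have "c = d" if c: "?P c" for c
    proof
      fix g
      let ?F = "{g \<in> carrier G. c g \<noteq> \<zero>\<^bsub>R\<^esub>}"
      have cA: "c k \<in> A (inv\<^bsub>G\<^esub> k)" if "k \<in> carrier G" for k
        using c that by blast
      have cR: "c k \<in> carrier R" if "k \<in> carrier G" for k
        using component_carrier[OF G.inv_closed[OF that] cA[OF that]] .
      show "c g = d g"
      proof (cases "g \<in> carrier G")
        case True
        have "hpart x (inv\<^bsub>G\<^esub> g) = (if inv\<^bsub>G\<^esub> g \<in> (\<lambda>g. inv\<^bsub>G\<^esub> g) ` ?F then c (inv\<^bsub>G\<^esub> (inv\<^bsub>G\<^esub> g)) else \<zero>\<^bsub>R\<^esub>)"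
        proof (rule hpart_eqI[where c = "\<lambda>h. c (inv\<^bsub>G\<^esub> h)"])
          show "x = (\<Oplus>\<^bsub>R\<^esub>h\<in>(\<lambda>g. inv\<^bsub>G\<^esub> g) ` ?F. c (inv\<^bsub>G\<^esub> h))"
          proof -
            have "(\<Oplus>\<^bsub>R\<^esub>h\<in>(\<lambda>g. inv\<^bsub>G\<^esub> g) ` ?F. c (inv\<^bsub>G\<^esub> h)) = (\<Oplus>\<^bsub>R\<^esub>g\<in>?F. c (inv\<^bsub>G\<^esub> (inv\<^bsub>G\<^esub> g)))"
              using inj cR by (intro R.finsum_reindex) (auto simp: inj_on_def)
            also have "\<dots> = (\<Oplus>\<^bsub>R\<^esub>g\<in>?F. c g)"
              using cR by (intro R.add.finprod_cong') auto
            finally show ?thesis using c by simp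
          qed
        next
          fix h assume "h \<in> (\<lambda>g. inv\<^bsub>G\<^esub> g) ` ?F"
          then show "c (inv\<^bsub>G\<^esub> h) \<in> A h"
            using cA by force
        qed (use c True in auto)
        moreover have "inv\<^bsub>G\<^esub> g \<in> (\<lambda>g. inv\<^bsub>G\<^esub> g) ` ?F \<longleftrightarrow> c g \<noteq> \<zero>\<^bsub>R\<^esub>"
          using True inj by (auto simp: inj_on_def)
        ultimately show ?thesis
          using True by (auto simp: d_def)
      next
        case False
        then show ?thesis
          using c by (auto simp: d_def PiE_iff extensional_def)
      qed
    qed
    ultimately have "\<exists>!c. ?P c"
      by (rule ex1I)
    then show "\<exists>!c. c \<in> (\<Pi>\<^sub>E g\<in>carrier G. A (inv\<^bsub>G\<^esub> g)) \<and>
        finite {g \<in> carrier G. c g \<noteq> \<zero>\<^bsub>opposite_ring R\<^esub>} \<and>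
        x = (\<Oplus>\<^bsub>opposite_ring R\<^esub>g\<in>{g \<in> carrier G. c g \<noteq> \<zero>\<^bsub>opposite_ring R\<^esub>}. c g)"
      by simp
  qed
qed

end

theorem theoremA:
  fixes G :: "('g, 'm) monoid_scheme"
    and R :: "('r, 'n) ring_scheme"
    and A :: "'g \<Rightarrow> 'r set"
  assumes "strongly_graded_ring G R A"
    and "noncommutative_domain (base_ring G R A)"
  shows "(SRC R \<longleftrightarrow> SRC (base_ring G R A) \<and> amenable G) \<and>
         (LSRC R \<longleftrightarrow> LSRC (base_ring G R A) \<and> amenable G)"
proof -
  interpret strongly_graded_over_domain G R A
    using assms by (intro strongly_graded_over_domain.intro strongly_graded_over_domain_axioms.intro)
  interpret op: strongly_graded_over_domain G "opposite_ring R" "\<lambda>g. A (inv\<^bsub>G\<^esub> g)"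
    by (rule opposite_graded)
  have "LSRC R \<longleftrightarrow> LSRC B \<and> amenable G"
    using op.SRC_iff unfolding base_ring_opposite SRC_opposite_ring .
  with SRC_iff show ?thesis by blast
qed

end
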